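(* Let $\mathcal L$ be an $M$-structure such that $\mathcal A$ has a basis $\{1,A_1,\dots,A_p\}$ with $A_iA_j=\delta_{i,j}A_i$, and let $\{1,B^1,\dots,B^p\}$ be the dual basis of $\mathcal B$, $(A_i,B^j)=\delta_i^j$. Then, after an appropriate shift $B^i\to B^i+c_i$ with constants $c_i\in\mathbb C$, the algebra $\mathcal B$ is given by $$B^iB^j=(u_i-q_{i,j})B^i+q_{i,j}B^j+v_i\quad (i\ne j),\qquad (B^i)^2=u_iB^i+v_i,$$ where the constants $u_i,v_i,q_{i,j}$ satisfy $$q_{i,j}^2=u_iq_{i,j}+v_i,\qquad (u_i-q_{i,j})^2=u_j(u_i-q_{i,j})+v_j\qquad (i\ne j),$$ $$(q_{i,k}-q_{j,k})(q_{i,k}-q_{i,j})=0\qquad\text{for pairwise distinct } i,j,k.$$ The corresponding algebra $U(\mathcal L)$ is determined by the relations $A_iA_j=\delta_{i,j}A_i$, $B^iB^j=(u_i-q_{i,j})B^i+q_{i,j}B^j+v_i$ for $i\ne j$, $(B^i)^2=u_iB^i+v_i$, and $$B^iA_j=(u_j-q_{j,i})A_j\quad (i\ne j),\qquad B^iA_i=u_iA_i+\sum_{k\ne i}q_{k,i}A_k+B^i+C,$$ $$B^iC=\sum_{1\le k\le p}v_kA_k-u_iB^i-v_i,\qquad CA_j=-u_jA_j,$$ where $C$ is the element of $\mathcal L$ completing the (shifted) basis to an adapted basis.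
   Context: Indices $i,j,k$ run over $1,\dots,p$; scalars in algebra identities mean multiples of $1$. A weak $M$-structure on a finite-dimensional complex vector space $\mathcal L$ consists of: two subspaces $\mathcal A,\mathcal B\subset\mathcal L$ and an element $1\in\mathcal A\cap\mathcal B$; a non-degenerate symmetric bilinear form $(\cdot,\cdot)$ on $\mathcal L$; associative products on $\mathcal A$ and on $\mathcal B$, both with unity $1$; a left (unital) action of $\mathcal B$ on $\mathcal L$ and a right (unital) action of $\mathcal A$ on $\mathcal L$ that commute with each other; such that (1) $\mathcal A\cap\mathcal B=\mathbb C\,1$ is one-dimensional and $\dim\mathcal L/(\mathcal A+\mathcal B)=1$; (2) the action of $\mathcal B$ restricted to $\mathcal B\subset\mathcal L$ is the product of $\mathcal B$, and the action of $\mathcal A$ restricted to $\mathcal A\subset\mathcal L$ is the product of $\mathcal A$; (3) $(a_1,a_2)=(b_1,b_2)=0$, $(b_1b_2,v)=(b_1,b_2v)$, $(v,a_1a_2)=(va_1,a_2)$ for all $a_1,a_2\in\mathcal A$, $b_1,b_2\in\mathcal B$, $v\in\mathcal L$. The weak $M$-algebra $U(\mathcal L)$ is the associative algebra with unit $1\in\mathcal L$ such that $\mathcal L\subset U(\mathcal L)$, the products $bv$ and $va$ ($b\in\mathcal B$, $a\in\mathcal A$, $v\in\mathcal L$) in $U(\mathcal L)$ are the given actions, and which is universal: for any associative algebra $X$ with these properties there is a unique algebra homomorphism $U(\mathcal L)\to X$ that is the identity on $\mathcal L$. Adapted basis: $\{1,A_1,\dots,A_p\}$ is a basis of $\mathcal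 A$, $\{1,B^1,\dots,B^p\}$ a basis of $\mathcal B$ with $(A_i,B^j)=\delta_i^j$, and $C\in\mathcal L$ is the unique element with $(1,C)=1$ and $(C,C)=(C,A_i)=(C,B^j)=0$ for all $i,j$. Put $K=\sum_iA_iB^i+C\in U(\mathcal L)$ (independent of the choice of adapted basis). A weak $M$-structure is called an $M$-structure if $K$ is central in $U(\mathcal L)$. *)

theory Defs
  imports Complex_Main "HOL-Library.Poly_Mapping" "HOL-Algebra.QuotRing"
begin

subsection \<open>Complex algebras given by generators and relations\<close>

datatype 'g fword = FWord (letters: "'g list")

instantiation fword :: (type) monoid_add
begin

definition zero_fword :: "'a fword" where
  "zero_fword = FWord []"

definition plus_fword :: "'a fword \<Rightarrow> 'a fword \<Rightarrow> 'a fword" where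
  "plus_fword w w' = FWord (letters w @ letters w')"

instance
  by standard (simp_all add: zero_fword_def plus_fword_def)

end

text \<open>\<^typ>\<open>'g fword\<close> is the free monoid on \<^typ>\<open>'g\<close>, written additively, so that its monoid
  algebra, with the convolution product of the library, is the free unital associative algebra.\<close>

type_synonym 'g free_alg = "'g fword \<Rightarrow>\<^sub>0 complex"

definition gen :: "'g \<Rightarrow> 'g free_alg" where
  "gen g = Poly_Mapping.single (FWord [g]) 1"

definition scal :: "complex \<Rightarrow> 'g free_alg" where
  "scal c = Poly_Mapping.single 0 c"

definition free_alg_on :: "'g set \<Rightarrow> 'g free_alg ring" where
  "free_alg_on S =
     \<lparr>carrier = {x. \<forall>w \<in> Poly_Mapping.keys x. set (letters w) \<subseteq> S},
      mult = (*), one = 1, zero = 0, add = (+)\<rparr>"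

text \<open>A two-sided ring ideal of a free algebra is automatically a complex subspace, because the
  scalars are themselves elements of the algebra.\<close>

definition presented :: "'g set \<Rightarrow> 'g free_alg set \<Rightarrow> 'g free_alg set ring" where
  "presented S R = free_alg_on S Quot (genideal (free_alg_on S) R)"

definition pclass :: "'g set \<Rightarrow> 'g free_alg set \<Rightarrow> 'g free_alg \<Rightarrow> 'g free_alg set" where
  "pclass S R x = genideal (free_alg_on S) R +>\<^bsub>free_alg_on S\<^esub> x"


subsection \<open>Weak M-structures\<close>

text \<open>The space \<open>\<L>\<close> is the type \<^typ>\<open>'l\<close> with scalar multiplication \<open>mscale\<close>. Only the values
  of \<open>mulA\<close>, \<open>mulB\<close> on \<open>spA\<close>, \<open>spB\<close>, of \<open>lact b v\<close> for \<open>b\<close> in \<open>spB\<close>, and of \<open>ract v a\<close> for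
  \<open>a\<close> in \<open>spA\<close> are relevant.\<close>

record 'l mdata =
  mscale :: "complex \<Rightarrow> 'l \<Rightarrow> 'l"
  spA :: "'l set"
  spB :: "'l set"
  munit :: 'l
  mform :: "'l \<Rightarrow> 'l \<Rightarrow> complex"
  mulA :: "'l \<Rightarrow> 'l \<Rightarrow> 'l"
  mulB :: "'l \<Rightarrow> 'l \<Rightarrow> 'l"
  lact :: "'l \<Rightarrow> 'l \<Rightarrow> 'l"
  ract :: "'l \<Rightarrow> 'l \<Rightarrow> 'l"

definition bilinear_on ::
    "(complex \<Rightarrow> 'l \<Rightarrow> 'l) \<Rightarrow> (complex \<Rightarrow> 'm \<Rightarrow> 'm) \<Rightarrow> 'l set \<Rightarrow> 'l set
      \<Rightarrow> ('l::ab_group_add \<Rightarrow> 'l \<Rightarrow> 'm::ab_group_add) \<Rightarrow> bool" where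
  "bilinear_on s t V W f \<longleftrightarrow>
     (\<forall>x\<in>V. \<forall>x'\<in>V. \<forall>y\<in>W. f (x + x') y = f x y + f x' y) \<and>
     (\<forall>x\<in>V. \<forall>y\<in>W. \<forall>y'\<in>W. f x (y + y') = f x y + f x y') \<and>
     (\<forall>c. \<forall>x\<in>V. \<forall>y\<in>W. f (s c x) y = t c (f x y) \<and> f x (s c y) = t c (f x y))"

definition unital_algebra_on ::
    "(complex \<Rightarrow> 'l \<Rightarrow> 'l) \<Rightarrow> 'l set \<Rightarrow> 'l \<Rightarrow> ('l::ab_group_add \<Rightarrow> 'l \<Rightarrow> 'l) \<Rightarrow> bool" where
  "unital_algebra_on s V e m \<longleftrightarrow>
     (\<forall>x\<in>V. \<forall>y\<in>V. m x y \<in> V) \<and>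
     bilinear_on s s V V m \<and>
     (\<forall>x\<in>V. \<forall>y\<in>V. \<forall>z\<in>V. m (m x y) z = m x (m y z)) \<and>
     (\<forall>x\<in>V. m e x = x \<and> m x e = x)"

definition weak_M_structure :: "('l::ab_group_add) mdata \<Rightarrow> bool" where
  "weak_M_structure L \<longleftrightarrow>
     vector_space (mscale L) \<and>
     (\<exists>S. finite S \<and> module.span (mscale L) S = UNIV) \<and>
     module.subspace (mscale L) (spA L) \<and>
     module.subspace (mscale L) (spB L) \<and>
     munit L \<in> spA L \<inter> spB L \<and>
     bilinear_on (mscale L) (*) UNIV UNIV (mform L) \<and>
     (\<forall>x y. mform L x y = mform L y x) \<and>
     (\<forall>x. (\<forall>y. mform L x y = 0) \<longrightarrow> x = 0) \<and>
     unital_algebra_on (mscale L) (spA L) (munit L) (mulA L) \<and>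
     unital_algebra_on (mscale L) (spB L) (munit L) (mulB L) \<and>
     bilinear_on (mscale L) (mscale L) (spB L) UNIV (lact L) \<and>
     (\<forall>v. lact L (munit L) v = v) \<and>
     (\<forall>b1\<in>spB L. \<forall>b2\<in>spB L. \<forall>v. lact L (mulB L b1 b2) v = lact L b1 (lact L b2 v)) \<and>
     bilinear_on (mscale L) (mscale L) UNIV (spA L) (ract L) \<and>
     (\<forall>v. ract L v (munit L) = v) \<and>
     (\<forall>a1\<in>spA L. \<forall>a2\<in>spA L. \<forall>v. ract L v (mulA L a1 a2) = ract L (ract L v a1) a2) \<and>
     (\<forall>b\<in>spB L. \<forall>a\<in>spA L. \<forall>v. ract L (lact L b v) a = lact L b (ract L v a)) \<and>
     spA L \<inter> spB L = module.span (mscale L) {munit L} \<and>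
     vector_space.dim (mscale L) (spA L \<inter> spB L) = 1 \<and>
     \<comment> \<open>as \<open>\<L>\<close> is finite-dimensional, this says \<open>dim \<L>/(\<A>+\<B>) = 1\<close>\<close>
     vector_space.dim (mscale L) (UNIV :: 'l set) =
       vector_space.dim (mscale L) {a + b | a b. a \<in> spA L \<and> b \<in> spB L} + 1 \<and>
     (\<forall>b1\<in>spB L. \<forall>b2\<in>spB L. lact L b1 b2 = mulB L b1 b2) \<and>
     (\<forall>a1\<in>spA L. \<forall>a2\<in>spA L. ract L a1 a2 = mulA L a1 a2) \<and>
     (\<forall>a1\<in>spA L. \<forall>a2\<in>spA L. mform L a1 a2 = 0) \<and>
     (\<forall>b1\<in>spB L. \<forall>b2\<in>spB L. mform L b1 b2 = 0) \<and>
     (\<forall>b1\<in>spB L. \<forall>b2\<in>spB L. \<forall>v. mform L (mulB L b1 b2) v = mform L b1 (lact L b2 v)) \<and>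
     (\<forall>a1\<in>spA L. \<forall>a2\<in>spA L. \<forall>v. mform L v (mulA L a1 a2) = mform L (ract L v a1) a2)"


subsection \<open>The weak M-algebra\<close>

text \<open>The generators are all elements of \<open>\<L>\<close>. The defining universal property is proved below in
  \<open>weak_M_algebra_realizes\<close>, \<open>weak_M_algebra_hom_unique\<close> and \<open>weak_M_algebra_hom_exists\<close>.\<close>

definition weak_M_rels :: "('l::ab_group_add) mdata \<Rightarrow> 'l free_alg set" where
  "weak_M_rels L =
     {gen (v + w) - (gen v + gen w) | v w. True} \<union>
     {gen (mscale L c v) - scal c * gen v | c v. True} \<union>
     {gen (munit L) - 1} \<union>
     {gen b * gen v - gen (lact L b v) | b v. b \<in> spB L} \<union>
     {gen v * gen a - gen (ract L v a) | v a. a \<in> spA L}"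

definition weak_M_algebra :: "('l::ab_group_add) mdata \<Rightarrow> 'l free_alg set ring" where
  "weak_M_algebra L = presented UNIV (weak_M_rels L)"

definition emb :: "('l::ab_group_add) mdata \<Rightarrow> 'l \<Rightarrow> 'l free_alg set" where
  "emb L v = pclass UNIV (weak_M_rels L) (gen v)"

definition uscal :: "('l::ab_group_add) mdata \<Rightarrow> complex \<Rightarrow> 'l free_alg set" where
  "uscal L c = pclass UNIV (weak_M_rels L) (scal c)"


subsection \<open>The universal property\<close>

text \<open>A complex algebra is a ring \<open>X\<close> with a structure map \<open>\<sigma>\<close> from the scalars to its centre;
  \<open>f\<close> is a linear map from \<open>\<L>\<close> that turns the unit and both actions into those of \<open>X\<close>.\<close>

definition complex_algebra :: "('x, 'm) ring_scheme \<Rightarrow> (complex \<Rightarrow> 'x) \<Rightarrow> bool" where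
  "complex_algebra X \<sigma> \<longleftrightarrow>
     ring X \<and> (\<forall>c. \<sigma> c \<in> carrier X) \<and> \<sigma> 1 = \<one>\<^bsub>X\<^esub> \<and>
     (\<forall>c d. \<sigma> (c + d) = \<sigma> c \<oplus>\<^bsub>X\<^esub> \<sigma> d) \<and> (\<forall>c d. \<sigma> (c * d) = \<sigma> c \<otimes>\<^bsub>X\<^esub> \<sigma> d) \<and>
     (\<forall>c. \<forall>x\<in>carrier X. \<sigma> c \<otimes>\<^bsub>X\<^esub> x = x \<otimes>\<^bsub>X\<^esub> \<sigma> c)"

definition realizes ::
    "('l::ab_group_add) mdata \<Rightarrow> ('x, 'm) ring_scheme \<Rightarrow> (complex \<Rightarrow> 'x) \<Rightarrow> ('l \<Rightarrow> 'x) \<Rightarrow> bool" where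
  "realizes L X \<sigma> f \<longleftrightarrow>
     complex_algebra X \<sigma> \<and> (\<forall>v. f v \<in> carrier X) \<and>
     (\<forall>v w. f (v + w) = f v \<oplus>\<^bsub>X\<^esub> f w) \<and>
     (\<forall>c v. f (mscale L c v) = \<sigma> c \<otimes>\<^bsub>X\<^esub> f v) \<and>
     f (munit L) = \<one>\<^bsub>X\<^esub> \<and>
     (\<forall>b\<in>spB L. \<forall>v. f b \<otimes>\<^bsub>X\<^esub> f v = f (lact L b v)) \<and>
     (\<forall>a\<in>spA L. \<forall>v. f v \<otimes>\<^bsub>X\<^esub> f a = f (ract L v a))"

lemma carrier_free_UNIV [simp]: "carrier (free_alg_on UNIV) = UNIV"
  by (simp add: free_alg_on_def)

lemma free_UNIV_simps [simp]:
  "x \<otimes>\<^bsub>free_alg_on S\<^esub> y = x * y" "\<one>\<^bsub>free_alg_on S\<^esub> = 1"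
  "x \<oplus>\<^bsub>free_alg_on S\<^esub> y = x + y" "\<zero>\<^bsub>free_alg_on S\<^esub> = 0"
  by (simp_all add: free_alg_on_def)

lemma ring_free_UNIV: "ring (free_alg_on (UNIV :: 'g set))"
proof (rule ringI)
  show "abelian_group (free_alg_on (UNIV :: 'g set))"
  proof (rule abelian_groupI)
    fix x :: "'g free_alg"
    show "\<exists>y\<in>carrier (free_alg_on UNIV). y \<oplus>\<^bsub>free_alg_on UNIV\<^esub> x = \<zero>\<^bsub>free_alg_on UNIV\<^esub>"
      by (auto intro: exI[of _ "- x"])
  qed (simp_all add: algebra_simps)
  show "Group.monoid (free_alg_on (UNIV :: 'g set))"
    by (rule monoidI) (simp_all add: mult.assoc)
qed (simp_all add: algebra_simps)

lemma free_alg_induct [case_names zero step]: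
  fixes x :: "'g free_alg"
  assumes "P 0" and "\<And>x w c. P x \<Longrightarrow> P (x + Poly_Mapping.single w c)"
  shows "P x"
proof (induction x rule: Poly_Mapping.update_induct)
  case const
  then show ?case using assms(1) by simp
next
  case (update f a b)
  have "Poly_Mapping.update a b f = f + Poly_Mapping.single a b"
    using update.hyps
    by (intro poly_mapping_eqI)
      (auto simp: lookup_update lookup_add lookup_single when_def not_in_keys_iff_lookup_eq_zero)
  then show ?case using assms(2) update by metis
qed

lemma single_Cons:
  "Poly_Mapping.single (FWord (g # gs)) c = gen g * (Poly_Mapping.single (FWord gs) c :: 'g free_alg)"
  by (simp add: gen_def mult_single plus_fword_def)

lemma scal_simps:
  "scal (c + d) = scal c + scal d" "scal (c * d) = scal c * scal d" "scal 1 = 1" "scal 0 = 0"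
  by (simp_all add: scal_def single_add mult_single)

lemma scal_central: "scal c * x = x * scal c"
proof (induction x rule: free_alg_induct)
  case (step x w d)
  then show ?case by (simp add: algebra_simps scal_def mult_single)
qed simp

lemma pclass_surj:
  "y \<in> carrier (presented UNIV R) \<Longrightarrow> \<exists>x. y = pclass UNIV R x"
  by (auto simp: presented_def pclass_def FactRing_def A_RCOSETS_defs a_r_coset_def)

lemma ideal_UNIV: "ideal (genideal (free_alg_on UNIV) R) (free_alg_on UNIV)"
  by (rule ring.genideal_ideal[OF ring_free_UNIV]) simp

lemma pclass_hom: "pclass UNIV R \<in> ring_hom (free_alg_on UNIV) (presented UNIV R)"
  using ideal.rcos_ring_hom[OF ideal_UNIV] by (simp add: pclass_def[abs_def] presented_def)

lemma ring_presented: "ring (presented UNIV R)"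
  using ideal.quotient_is_ring[OF ideal_UNIV] by (simp add: presented_def)

lemma pclass_simps:
  "pclass UNIV R x \<in> carrier (presented UNIV R)"
  "pclass UNIV R (x + y) = pclass UNIV R x \<oplus>\<^bsub>presented UNIV R\<^esub> pclass UNIV R y"
  "pclass UNIV R (x * y) = pclass UNIV R x \<otimes>\<^bsub>presented UNIV R\<^esub> pclass UNIV R y"
  "pclass UNIV R 1 = \<one>\<^bsub>presented UNIV R\<^esub>"
  using pclass_hom[of R] by (auto simp: ring_hom_def)

lemma pclass_eqI:
  assumes "x - y \<in> R"
  shows "pclass UNIV R x = pclass UNIV R y"
proof -
  interpret ideal "genideal (free_alg_on UNIV) R" "free_alg_on UNIV" by (rule ideal_UNIV)
  have "x - y \<in> genideal (free_alg_on UNIV) R"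
    using ring.genideal_self[OF ring_free_UNIV, of R] assms by auto
  then have "x \<in> genideal (free_alg_on UNIV) R +>\<^bsub>free_alg_on UNIV\<^esub> y"
    by (auto simp: a_r_coset_def r_coset_def intro!: bexI[of _ "x - y"])
  then show ?thesis
    unfolding pclass_def using a_repr_independence a_subgroup by (metis UNIV_I carrier_free_UNIV)
qed

text \<open>The canonical map from \<open>\<L>\<close> to the weak M-algebra has the required properties, \<dots>\<close>

lemma weak_M_algebra_realizes: "realizes L (weak_M_algebra L) (uscal L) (emb L)"
proof -
  let ?R = "weak_M_rels L"
  note [simp] = pclass_simps(1) and * = pclass_simps(2-4)[of ?R, symmetric]
  have "complex_algebra (weak_M_algebra L) (uscal L)"
    unfolding complex_algebra_def weak_M_algebra_def uscal_def
  proof (intro conjI allI ballI ring_presented)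
    fix c x assume "x \<in> carrier (presented UNIV ?R)"
    then obtain y where "x = pclass UNIV ?R y" using pclass_surj by metis
    then show "pclass UNIV ?R (scal c) \<otimes>\<^bsub>presented UNIV ?R\<^esub> x
        = x \<otimes>\<^bsub>presented UNIV ?R\<^esub> pclass UNIV ?R (scal c)"
      by (simp add: * scal_central)
  qed (simp_all add: * scal_simps)
  moreover have
    "gen (v + w) - (gen v + gen w) \<in> ?R" "gen (mscale L c v) - scal c * gen v \<in> ?R"
    "gen (munit L) - 1 \<in> ?R" for v w c
    by (auto simp: weak_M_rels_def)
  moreover have "gen b * gen v - gen (lact L b v) \<in> ?R" if "b \<in> spB L" for b v
    using that by (auto simp: weak_M_rels_def)
  moreover have "gen v * gen a - gen (ract L v a) \<in> ?R" if "a \<in> spA L" for a v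
    using that by (auto simp: weak_M_rels_def)
  ultimately show ?thesis
    unfolding realizes_def
    by (simp add: weak_M_algebra_def uscal_def emb_def * pclass_eqI)
qed

text \<open>\<dots> and it is universal with these properties, even among targets \<open>X\<close> into which \<open>\<L>\<close> is not
  mapped injectively. The map \<^const>\<open>emb\<close> itself is injective for every weak M-structure: rewriting
  \<open>bv\<close> and \<open>va\<close> to elements of \<open>\<L>\<close> is confluent by the module axioms. No definition depends on
  this.\<close>

lemma weak_M_algebra_hom_unique:
  assumes "h \<in> ring_hom (weak_M_algebra L) X" "h' \<in> ring_hom (weak_M_algebra L) X"
    and "\<And>v. h (emb L v) = h' (emb L v)" and "\<And>c. h (uscal L c) = h' (uscal L c)"
    and "y \<in> carrier (weak_M_algebra L)"
  shows "h y = h' y"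
proof -
  let ?p = "pclass UNIV (weak_M_rels L)"
  note [simp] = pclass_simps[of "weak_M_rels L", folded weak_M_algebra_def]
    ring_hom_add[OF assms(1)] ring_hom_add[OF assms(2)]
    ring_hom_mult[OF assms(1)] ring_hom_mult[OF assms(2)]
  have s: "h (?p (Poly_Mapping.single w c)) = h' (?p (Poly_Mapping.single w c))" for w c
  proof (cases w)
    case (FWord gs)
    have "h (?p (Poly_Mapping.single (FWord gs) c)) = h' (?p (Poly_Mapping.single (FWord gs) c))"
    proof (induction gs)
      case Nil
      show ?case
        using assms(4)[of c] by (simp add: uscal_def scal_def zero_fword_def)
    next
      case (Cons g gs)
      then show ?case
        using assms(3)[of g] by (simp add: single_Cons emb_def)
    qed
    then show ?thesis using FWord by simp
  qed
  obtain x where y: "y = ?p x" using assms(5) pclass_surj unfolding weak_M_algebra_def by metis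
  have "h (?p x) = h' (?p x)"
  proof (induction x rule: free_alg_induct)
    case zero
    show ?case using s[of 0 0] by simp
  next
    case (step x w c)
    then show ?case using s by simp
  qed
  then show ?thesis using y by simp
qed

fun word_eval :: "('x, 'm) ring_scheme \<Rightarrow> ('g \<Rightarrow> 'x) \<Rightarrow> 'g list \<Rightarrow> 'x" where
  "word_eval X f [] = \<one>\<^bsub>X\<^esub>"
| "word_eval X f (g # gs) = f g \<otimes>\<^bsub>X\<^esub> word_eval X f gs"

definition free_eval ::
    "('x, 'm) ring_scheme \<Rightarrow> (complex \<Rightarrow> 'x) \<Rightarrow> ('g \<Rightarrow> 'x) \<Rightarrow> 'g free_alg \<Rightarrow> 'x" where
  "free_eval X \<sigma> f x = (\<Oplus>\<^bsub>X\<^esub> w\<in>Poly_Mapping.keys x.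
     \<sigma> (Poly_Mapping.lookup x w) \<otimes>\<^bsub>X\<^esub> word_eval X f (letters w))"

lemma free_eval_props:
  fixes f :: "'g \<Rightarrow> 'x"
  assumes X: "complex_algebra X \<sigma>" and f: "\<And>g. f g \<in> carrier X"
  shows "free_eval X \<sigma> f \<in> ring_hom (free_alg_on UNIV) X"
    and "free_eval X \<sigma> f (gen g) = f g" and "free_eval X \<sigma> f (scal c) = \<sigma> c"
proof -
  interpret ring X using X unfolding complex_algebra_def by blast
  have sc [simp]: "\<sigma> c \<in> carrier X" for c using X unfolding complex_algebra_def by blast
  have s1: "\<sigma> 1 = \<one>\<^bsub>X\<^esub>" and sadd: "\<sigma> (c + d) = \<sigma> c \<oplus>\<^bsub>X\<^esub> \<sigma> d"
    and smult: "\<sigma> (c * d) = \<sigma> c \<otimes>\<^bsub>X\<^esub> \<sigma> d" for c d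
    using X unfolding complex_algebra_def by blast+
  have s0: "\<sigma> 0 = \<zero>\<^bsub>X\<^esub>"
  proof -
    have "\<sigma> 0 = \<sigma> 0 \<oplus>\<^bsub>X\<^esub> \<sigma> 0" using sadd[of 0 0] by simp
    then show ?thesis by (simp add: sc)
  qed
  have wc [simp]: "word_eval X f gs \<in> carrier X" for gs
    by (induction gs) (simp_all add: f)
  have wapp: "word_eval X f (gs @ gs') = word_eval X f gs \<otimes>\<^bsub>X\<^esub> word_eval X f gs'" for gs gs'
    by (induction gs) (simp_all add: f m_assoc)
  let ?e = "free_eval X \<sigma> f"
  let ?t = "\<lambda>x w. \<sigma> (Poly_Mapping.lookup x w) \<otimes>\<^bsub>X\<^esub> word_eval X f (letters w)"
  have ec [simp]: "?e x \<in> carrier X" for x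
    by (simp add: free_eval_def Pi_def)
  have sup: "?e x = (\<Oplus>\<^bsub>X\<^esub> w\<in>T. ?t x w)" if "finite T" "Poly_Mapping.keys x \<subseteq> T" for x T
    unfolding free_eval_def using that
    by (intro add.finprod_mono_neutral_cong_left)
      (auto simp: s0 not_in_keys_iff_lookup_eq_zero Pi_def in_keys_iff)
  have add: "?e (x + y) = ?e x \<oplus>\<^bsub>X\<^esub> ?e y" for x y
  proof -
    let ?T = "Poly_Mapping.keys x \<union> Poly_Mapping.keys y"
    have "?e (x + y) = (\<Oplus>\<^bsub>X\<^esub> w\<in>?T. ?t (x + y) w)"
      by (rule sup) (use keys_add[of x y] in auto)
    also have "\<dots> = (\<Oplus>\<^bsub>X\<^esub> w\<in>?T. ?t x w \<oplus>\<^bsub>X\<^esub> ?t y w)"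
      by (intro finsum_cong') (auto simp: lookup_add sadd l_distr)
    also have "\<dots> = (\<Oplus>\<^bsub>X\<^esub> w\<in>?T. ?t x w) \<oplus>\<^bsub>X\<^esub> (\<Oplus>\<^bsub>X\<^esub> w\<in>?T. ?t y w)"
      by (intro finsum_addf) auto
    also have "\<dots> = ?e x \<oplus>\<^bsub>X\<^esub> ?e y"
      using sup[of ?T x] sup[of ?T y] by simp
    finally show ?thesis .
  qed
  have single: "?e (Poly_Mapping.single w c) = \<sigma> c \<otimes>\<^bsub>X\<^esub> word_eval X f (letters w)" for w c
  proof -
    have "?e (Poly_Mapping.single w c) = (\<Oplus>\<^bsub>X\<^esub> w'\<in>{w}. ?t (Poly_Mapping.single w c) w')"
      by (rule sup) auto
    then show ?thesis by simp
  qed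
  have e0: "?e 0 = \<zero>\<^bsub>X\<^esub>" by (simp add: free_eval_def)
  have mult1: "?e (Poly_Mapping.single w c * Poly_Mapping.single w' c')
      = ?e (Poly_Mapping.single w c) \<otimes>\<^bsub>X\<^esub> ?e (Poly_Mapping.single w' c')" for w c w' c'
  proof -
    let ?a = "word_eval X f (letters w)" and ?b = "word_eval X f (letters w')"
    have "\<sigma> (c * c') \<otimes>\<^bsub>X\<^esub> (?a \<otimes>\<^bsub>X\<^esub> ?b) = \<sigma> c \<otimes>\<^bsub>X\<^esub> (\<sigma> c' \<otimes>\<^bsub>X\<^esub> ?a) \<otimes>\<^bsub>X\<^esub> ?b"
      by (simp add: smult m_assoc)
    also have "\<sigma> c' \<otimes>\<^bsub>X\<^esub> ?a = ?a \<otimes>\<^bsub>X\<^esub> \<sigma> c'" using X wc unfolding complex_algebra_def by blast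
    finally show ?thesis
      by (simp add: mult_single single wapp plus_fword_def m_assoc)
  qed
  have mult2: "?e (x * Poly_Mapping.single w' c') = ?e x \<otimes>\<^bsub>X\<^esub> ?e (Poly_Mapping.single w' c')" for x w' c'
    by (induction x rule: free_alg_induct)
      (simp_all add: e0 distrib_right add mult1 l_distr)
  have mult: "?e (x * y) = ?e x \<otimes>\<^bsub>X\<^esub> ?e y" for x y
    by (induction y rule: free_alg_induct)
      (simp_all add: e0 distrib_left add mult2 r_distr)
  have one: "?e 1 = \<one>\<^bsub>X\<^esub>"
    using single[of 0 1] by (simp add: s1) (simp add: s1 zero_fword_def)
  show "?e \<in> ring_hom (free_alg_on UNIV) X"
    by (rule ring_hom_memI) (simp_all add: mult add one)
  show "?e (gen g) = f g" by (simp add: gen_def single s1 f)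
  show "?e (scal c) = \<sigma> c" by (simp add: scal_def single zero_fword_def)
qed

lemma weak_M_algebra_hom_exists:
  fixes L :: "('l::ab_group_add) mdata"
  assumes f: "realizes L X \<sigma> f"
  shows "\<exists>h \<in> ring_hom (weak_M_algebra L) X.
    (\<forall>v. h (emb L v) = f v) \<and> (\<forall>c. h (uscal L c) = \<sigma> c)"
proof -
  have X: "complex_algebra X \<sigma>" and fc: "\<And>v. f v \<in> carrier X"
    using f unfolding realizes_def by blast+
  let ?e = "free_eval X \<sigma> f" and ?F = "free_alg_on (UNIV :: 'l set)" and ?R = "weak_M_rels L"
  note e = free_eval_props[OF X fc]
  interpret X: ring X using X unfolding complex_algebra_def by blast
  interpret E: ring_hom_ring ?F X ?e
    by (rule ring_hom_ringI2[OF ring_free_UNIV X.ring_axioms e(1)])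
  have eadd: "?e (x + y) = ?e x \<oplus>\<^bsub>X\<^esub> ?e y" and emult: "?e (x * y) = ?e x \<otimes>\<^bsub>X\<^esub> ?e y"
    and e1: "?e 1 = \<one>\<^bsub>X\<^esub>" and ec: "?e x \<in> carrier X" for x y
    using E.hom_add[of x y] E.hom_mult[of x y] E.hom_one E.hom_closed[of x] by simp_all
  have ediff: "?e (x - y) = \<zero>\<^bsub>X\<^esub>" if "?e x = ?e y" for x y
  proof -
    have "?e x = ?e (x - y) \<oplus>\<^bsub>X\<^esub> ?e y" by (simp flip: eadd)
    then show ?thesis using that ec by (metis X.add.r_cancel_one')
  qed
  have "?R \<subseteq> a_kernel ?F X ?e"
    using f unfolding weak_M_rels_def a_kernel_def' realizes_def
    by (auto intro!: ediff simp: eadd emult e1 e(2,3))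
  then have sub: "genideal ?F ?R \<subseteq> a_kernel ?F X ?e"
    by (rule ring.genideal_minimal[OF ring_free_UNIV E.kernel_is_ideal])
  have im: "?e ` pclass UNIV ?R x = {?e x}" for x
  proof -
    have "?e z = ?e x" if z: "z \<in> pclass UNIV ?R x" for z
    proof -
      obtain k where k: "k \<in> genideal ?F ?R" "z = k + x"
        using z by (auto simp: pclass_def a_r_coset_def r_coset_def)
      then have "?e k = \<zero>\<^bsub>X\<^esub>" using sub unfolding a_kernel_def' by blast
      then show ?thesis using k(2) ec[of x] by (simp add: eadd)
    qed
    moreover have "x \<in> pclass UNIV ?R x"
      using additive_subgroup.zero_closed[OF ideal.axioms(1)[OF ideal_UNIV], of ?R]
      by (auto simp: pclass_def a_r_coset_def r_coset_def intro!: bexI[of _ 0])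
    ultimately show ?thesis by blast
  qed
  define h where "h y = the_elem (?e ` y)" for y
  have h: "h (pclass UNIV ?R x) = ?e x" for x by (simp add: h_def im)
  have "h \<in> ring_hom (weak_M_algebra L) X"
    unfolding weak_M_algebra_def
  proof (rule ring_hom_memI)
    fix y assume "y \<in> carrier (presented UNIV ?R)"
    then obtain x where x: "y = pclass UNIV ?R x" using pclass_surj by metis
    show "h y \<in> carrier X" by (simp add: x h ec)
    fix y' assume "y' \<in> carrier (presented UNIV ?R)"
    then obtain x' where x': "y' = pclass UNIV ?R x'" using pclass_surj by metis
    show "h (y \<otimes>\<^bsub>presented UNIV ?R\<^esub> y') = h y \<otimes>\<^bsub>X\<^esub> h y'"
      by (simp add: x x' h emult flip: pclass_simps(3))
    show "h (y \<oplus>\<^bsub>presented UNIV ?R\<^esub> y') = h y \<oplus>\<^bsub>X\<^esub> h y'"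
      by (simp add: x x' h eadd flip: pclass_simps(2))
  next
    show "h \<one>\<^bsub>presented UNIV ?R\<^esub> = \<one>\<^bsub>X\<^esub>"
      by (simp add: h e1 flip: pclass_simps(4))
  qed
  then show ?thesis by (intro bexI[of _ h]) (simp_all add: emb_def uscal_def h e(2,3))
qed


subsection \<open>Adapted bases and M-structures\<close>

definition unital_basis ::
    "('l::ab_group_add) mdata \<Rightarrow> 'l set \<Rightarrow> nat \<Rightarrow> (nat \<Rightarrow> 'l) \<Rightarrow> bool" where
  "unital_basis L V p x \<longleftrightarrow>
     inj_on x {1..p} \<and> munit L \<notin> x ` {1..p} \<and>
     \<not> module.dependent (mscale L) (insert (munit L) (x ` {1..p})) \<and>
     module.span (mscale L) (insert (munit L) (x ` {1..p})) = V"

definition adapted_basis ::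
    "('l::ab_group_add) mdata \<Rightarrow> nat \<Rightarrow> (nat \<Rightarrow> 'l) \<Rightarrow> (nat \<Rightarrow> 'l) \<Rightarrow> 'l \<Rightarrow> bool" where
  "adapted_basis L p A B C \<longleftrightarrow>
     unital_basis L (spA L) p A \<and> unital_basis L (spB L) p B \<and>
     (\<forall>i\<in>{1..p}. \<forall>j\<in>{1..p}. mform L (A i) (B j) = (if i = j then 1 else 0)) \<and>
     mform L (munit L) C = 1 \<and> mform L C C = 0 \<and>
     (\<forall>i\<in>{1..p}. mform L C (A i) = 0 \<and> mform L C (B i) = 0)"

definition K_elem ::
    "('l::ab_group_add) mdata \<Rightarrow> nat \<Rightarrow> (nat \<Rightarrow> 'l) \<Rightarrow> (nat \<Rightarrow> 'l) \<Rightarrow> 'l \<Rightarrow> 'l free_alg set" where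
  "K_elem L p A B C =
     (\<Oplus>\<^bsub>weak_M_algebra L\<^esub> i\<in>{1..p}. emb L (A i) \<otimes>\<^bsub>weak_M_algebra L\<^esub> emb L (B i))
       \<oplus>\<^bsub>weak_M_algebra L\<^esub> emb L C"

text \<open>\<open>K\<close> does not depend on the adapted basis, and adapted bases exist, so it is immaterial that
  the following definition quantifies over all of them.\<close>

definition M_structure :: "('l::ab_group_add) mdata \<Rightarrow> bool" where
  "M_structure L \<longleftrightarrow>
     weak_M_structure L \<and>
     (\<forall>p A B C. adapted_basis L p A B C \<longrightarrow>
        (\<forall>x\<in>carrier (weak_M_algebra L).
           K_elem L p A B C \<otimes>\<^bsub>weak_M_algebra L\<^esub> x = x \<otimes>\<^bsub>weak_M_algebra L\<^esub> K_elem L p A B C))"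


subsection \<open>The presentation for semisimple commutative \<open>\<A>\<close>\<close>

datatype mgen = GA nat | GB nat | GC

definition mgens :: "nat \<Rightarrow> mgen set" where
  "mgens p = GA ` {1..p} \<union> GB ` {1..p} \<union> {GC}"

definition mrels ::
    "nat \<Rightarrow> (nat \<Rightarrow> complex) \<Rightarrow> (nat \<Rightarrow> complex) \<Rightarrow> (nat \<Rightarrow> nat \<Rightarrow> complex) \<Rightarrow> mgen free_alg set" where
  "mrels p u v q =
     {gen (GA i) * gen (GA j) - (if i = j then gen (GA i) else 0)
       | i j. i \<in> {1..p} \<and> j \<in> {1..p}} \<union>
     {gen (GB i) * gen (GB j)
         - (scal (u i - q i j) * gen (GB i) + scal (q i j) * gen (GB j) + scal (v i))
       | i j. i \<in> {1..p} \<and> j \<in> {1..p} \<and> i \<noteq> j} \<union>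
     {gen (GB i) * gen (GB i) - (scal (u i) * gen (GB i) + scal (v i))
       | i. i \<in> {1..p}} \<union>
     {gen (GB i) * gen (GA j) - scal (u j - q j i) * gen (GA j)
       | i j. i \<in> {1..p} \<and> j \<in> {1..p} \<and> i \<noteq> j} \<union>
     {gen (GB i) * gen (GA i)
         - (scal (u i) * gen (GA i) + (\<Sum>k\<in>{1..p} - {i}. scal (q k i) * gen (GA k))
             + gen (GB i) + gen GC)
       | i. i \<in> {1..p}} \<union>
     {gen (GB i) * gen GC
         - ((\<Sum>k\<in>{1..p}. scal (v k) * gen (GA k)) - scal (u i) * gen (GB i) - scal (v i))
       | i. i \<in> {1..p}} \<union>
     {gen GC * gen (GA j) - (- scal (u j) * gen (GA j))
       | j. j \<in> {1..p}}"

end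

theory Submission
  imports Defs
begin

text \<open>Acting on \<open>B\<^sup>iA\<^sub>j\<close> from the right by the idempotents \<open>A\<^sub>k\<close> kills
  all structure constants of \<open>\<B>\<close> except those in the asserted form, and the shift
  \<open>c\<^sub>i = (C, B\<^sup>iA\<^sub>i)\<close> removes the scalar part of \<open>B\<^sup>iA\<^sub>i\<close>. Associativity of the words
  \<open>B\<^sup>iB\<^sup>iB\<^sup>j\<close>, \<open>B\<^sup>iB\<^sup>jB\<^sup>j\<close>, \<open>B\<^sup>iB\<^sup>jB\<^sup>k\<close> then gives the equations for \<open>u\<close>, \<open>v\<close>, \<open>q\<close>. For any
  adapted basis \<open>U(\<L>)\<close> is presented by the action table of the basis elements: expanding a vector
  in the basis realizes \<open>\<L>\<close> in the presented algebra, so the universal property inverts the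
  evident map to \<open>U(\<L>)\<close>.\<close>

subsection \<open>Presented algebras on a set of generators\<close>

lemma free_alg_on_closed:
  fixes x y :: "'g free_alg"
  shows "0 \<in> carrier (free_alg_on S)" "1 \<in> carrier (free_alg_on S)"
    "scal c \<in> carrier (free_alg_on S)"
    "g \<in> S \<Longrightarrow> gen g \<in> carrier (free_alg_on S)"
    "x \<in> carrier (free_alg_on S) \<Longrightarrow> y \<in> carrier (free_alg_on S) \<Longrightarrow> x + y \<in> carrier (free_alg_on S)"
    "x \<in> carrier (free_alg_on S) \<Longrightarrow> - x \<in> carrier (free_alg_on S)"
    "x \<in> carrier (free_alg_on S) \<Longrightarrow> y \<in> carrier (free_alg_on S) \<Longrightarrow> x - y \<in> carrier (free_alg_on S)"
    "x \<in> carrier (free_alg_on S) \<Longrightarrow> y \<in> carrier (free_alg_on S) \<Longrightarrow> x * y \<in> carrier (free_alg_on S)"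
proof -
  show 1: "1 \<in> carrier (free_alg_on S)"
    unfolding single_one[symmetric] by (auto simp: free_alg_on_def zero_fword_def)
  show "scal c \<in> carrier (free_alg_on S)"
    by (auto simp: free_alg_on_def scal_def zero_fword_def)
  show "g \<in> S \<Longrightarrow> gen g \<in> carrier (free_alg_on S)"
    by (auto simp: free_alg_on_def gen_def)
  show "x \<in> carrier (free_alg_on S) \<Longrightarrow> y \<in> carrier (free_alg_on S) \<Longrightarrow> x + y \<in> carrier (free_alg_on S)"
    using keys_add[of x y] by (fastforce simp: free_alg_on_def)
  show "x \<in> carrier (free_alg_on S) \<Longrightarrow> y \<in> carrier (free_alg_on S) \<Longrightarrow> x - y \<in> carrier (free_alg_on S)"
    using keys_diff[of x y] by (fastforce simp: free_alg_on_def)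
  show "x \<in> carrier (free_alg_on S) \<Longrightarrow> y \<in> carrier (free_alg_on S) \<Longrightarrow> x * y \<in> carrier (free_alg_on S)"
    using keys_mult[of x y] by (fastforce simp: free_alg_on_def plus_fword_def)
qed (auto simp: free_alg_on_def)

lemma scal_minus: "scal (- c) = - scal c"
  by (simp add: scal_def single_uminus)

lemma scal_left_commute: "x * (scal c * y) = scal c * (x * y)"
  by (metis mult.assoc scal_central)

lemma free_alg_on_sum:
  assumes "\<And>i. i \<in> I \<Longrightarrow> f i \<in> carrier (free_alg_on S)"
  shows "sum f I \<in> carrier (free_alg_on S)"
  using assms by (induction I rule: infinite_finite_induct) (auto intro: free_alg_on_closed)

lemma ring_free_alg_on: "ring (free_alg_on S)"
proof (rule ringI)
  show "abelian_group (free_alg_on S)"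
  proof (rule abelian_groupI)
    fix x assume "x \<in> carrier (free_alg_on S)"
    then show "\<exists>y\<in>carrier (free_alg_on S). y \<oplus>\<^bsub>free_alg_on S\<^esub> x = \<zero>\<^bsub>free_alg_on S\<^esub>"
      by (intro bexI[of _ "- x"]) (auto intro: free_alg_on_closed)
  qed (auto simp: algebra_simps intro: free_alg_on_closed)
  show "Group.monoid (free_alg_on S)"
    by (rule monoidI) (auto simp: mult.assoc intro: free_alg_on_closed)
qed (auto simp: algebra_simps)

lemma free_alg_on_a_minus:
  assumes "x \<in> carrier (free_alg_on S)" "y \<in> carrier (free_alg_on S)"
  shows "x \<ominus>\<^bsub>free_alg_on S\<^esub> y = x - y"
proof -
  interpret ring "free_alg_on S" by (rule ring_free_alg_on)
  have "\<ominus>\<^bsub>free_alg_on S\<^esub> y = - y"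
    by (rule minus_equality) (use assms in \<open>auto intro: free_alg_on_closed\<close>)
  then show ?thesis by (simp add: a_minus_def)
qed

text \<open>A word with a coefficient is a scalar onto which letters are multiplied from the left,
  and every element is a finite sum of such terms. Carrier membership is kept in the induction
  hypotheses because homomorphisms out of \<open>free_alg_on S\<close> are multiplicative only
  there.\<close>

lemma free_alg_on_induct [consumes 1, case_names scal gen add]:
  assumes "x \<in> carrier (free_alg_on S)"
    and scal: "\<And>c. P (scal c)"
    and gen: "\<And>g x. g \<in> S \<Longrightarrow> x \<in> carrier (free_alg_on S) \<Longrightarrow> P x \<Longrightarrow> P (gen g * x)"
    and add: "\<And>x y. x \<in> carrier (free_alg_on S) \<Longrightarrow> y \<in> carrier (free_alg_on S) \<Longrightarrow>
      P x \<Longrightarrow> P y \<Longrightarrow> P (x + y)"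
  shows "P x"
proof -
  have word: "Poly_Mapping.single (FWord gs) c \<in> carrier (free_alg_on S) \<and>
      P (Poly_Mapping.single (FWord gs) c)" if "set gs \<subseteq> S" for gs c
    using that
  proof (induction gs)
    case Nil
    show ?case
      using scal[of c] free_alg_on_closed(3)[of c S] by (simp add: scal_def zero_fword_def)
  next
    case (Cons g gs)
    then show ?case by (simp add: single_Cons gen free_alg_on_closed)
  qed
  show ?thesis
    using assms(1)
  proof (induction x rule: Poly_Mapping.update_induct)
    case const
    show ?case using scal[of 0] by (simp add: scal_simps)
  next
    case (update f w c)
    have eq: "Poly_Mapping.update w c f = f + Poly_Mapping.single w c"
      using update.hyps
      by (intro poly_mapping_eqI)
        (auto simp: lookup_update lookup_add lookup_single when_def not_in_keys_iff_lookup_eq_zero)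
    obtain gs where w: "w = FWord gs" by (cases w)
    have "f \<in> carrier (free_alg_on S)" "set gs \<subseteq> S"
      using update.prems update.hyps w by (auto simp: free_alg_on_def keys_update)
    then show ?case
      unfolding eq unfolding w using word update.IH by (intro add) auto
  qed
qed

lemma free_alg_on_hom_unique:
  assumes h: "h \<in> ring_hom (free_alg_on S) X" "h' \<in> ring_hom (free_alg_on S) X"
    and scal: "\<And>c. h (scal c) = h' (scal c)"
    and gen: "\<And>g. g \<in> S \<Longrightarrow> h (gen g) = h' (gen g)"
    and x: "x \<in> carrier (free_alg_on S)"
  shows "h x = h' x"
  using x
proof (induction rule: free_alg_on_induct)
  case (gen g x)
  then show ?case
    using ring_hom_mult[OF h(1), of "gen g" x] ring_hom_mult[OF h(2), of "gen g" x] assms(4)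
    by (simp add: free_alg_on_closed)
next
  case (add x y)
  then show ?case
    using ring_hom_add[OF h(1), of x y] ring_hom_add[OF h(2), of x y] by simp
qed (rule scal)

section \<open>Quotients of the free algebra by relations\<close>

context
  fixes S :: "'g set" and R :: "'g free_alg set"
  assumes R: "R \<subseteq> carrier (free_alg_on S)"
begin

lemma ideal_presented: "ideal (genideal (free_alg_on S) R) (free_alg_on S)"
  by (rule ring.genideal_ideal[OF ring_free_alg_on R])

lemma presented_ideal_closed:
  "0 \<in> genideal (free_alg_on S) R"
  "x \<in> genideal (free_alg_on S) R \<Longrightarrow> y \<in> genideal (free_alg_on S) R \<Longrightarrow>
    x + y \<in> genideal (free_alg_on S) R"
  "x \<in> genideal (free_alg_on S) R \<Longrightarrow> scal c * x \<in> genideal (free_alg_on S) R"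
  "r \<in> R \<Longrightarrow> r \<in> genideal (free_alg_on S) R"
  using additive_subgroup.zero_closed[OF ideal.axioms(1)[OF ideal_presented]]
    additive_subgroup.a_closed[OF ideal.axioms(1)[OF ideal_presented], of x y]
    ideal.I_l_closed[OF ideal_presented, of x "scal c"] free_alg_on_closed(3)[of c S]
    ring.genideal_self[OF ring_free_alg_on R]
  by auto

lemma pclass_ring_hom: "pclass S R \<in> ring_hom (free_alg_on S) (presented S R)"
  using ideal.rcos_ring_hom[OF ideal_presented] by (simp add: pclass_def[abs_def] presented_def)

lemma pclass_eq_iff:
  assumes "x \<in> carrier (free_alg_on S)" "y \<in> carrier (free_alg_on S)"
  shows "pclass S R x = pclass S R y \<longleftrightarrow> x - y \<in> genideal (free_alg_on S) R"
  using ring.quotient_eq_iff_same_a_r_cos[OF ring_free_alg_on ideal_presented assms]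
  by (simp add: pclass_def free_alg_on_a_minus assms)

lemma pclass_hom_simps:
  "x \<in> carrier (free_alg_on S) \<Longrightarrow> pclass S R x \<in> carrier (presented S R)"
  "x \<in> carrier (free_alg_on S) \<Longrightarrow> y \<in> carrier (free_alg_on S) \<Longrightarrow>
    pclass S R (x + y) = pclass S R x \<oplus>\<^bsub>presented S R\<^esub> pclass S R y"
  "x \<in> carrier (free_alg_on S) \<Longrightarrow> y \<in> carrier (free_alg_on S) \<Longrightarrow>
    pclass S R (x * y) = pclass S R x \<otimes>\<^bsub>presented S R\<^esub> pclass S R y"
  "pclass S R 1 = \<one>\<^bsub>presented S R\<^esub>"
  using pclass_ring_hom by (auto simp: ring_hom_def)

lemma pclass_onto:
  assumes "y \<in> carrier (presented S R)"
  obtains x where "x \<in> carrier (free_alg_on S)" "y = pclass S R x"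
  using assms by (auto simp: presented_def pclass_def FactRing_def A_RCOSETS_defs a_r_coset_def)

lemma complex_algebra_presented: "complex_algebra (presented S R) (\<lambda>c. pclass S R (scal c))"
  unfolding complex_algebra_def
proof (intro conjI allI ballI)
  show "ring (presented S R)"
    using ideal.quotient_is_ring[OF ideal_presented] by (simp add: presented_def)
  show "pclass S R (scal c) \<in> carrier (presented S R)" for c
    by (simp add: pclass_hom_simps(1) free_alg_on_closed)
  fix c x assume "x \<in> carrier (presented S R)"
  then obtain y where "y \<in> carrier (free_alg_on S)" "x = pclass S R y" by (rule pclass_onto)
  then show "pclass S R (scal c) \<otimes>\<^bsub>presented S R\<^esub> x = x \<otimes>\<^bsub>presented S R\<^esub> pclass S R (scal c)"
    by (simp add: free_alg_on_closed scal_central flip: pclass_hom_simps(2-4))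
qed (simp_all add: free_alg_on_closed scal_simps flip: pclass_hom_simps(2-4))

text \<open>This is the first isomorphism theorem for evaluation. Its kernel contains
  \<open>R\<close> by \<open>rel\<close>, and it is no larger than the generated ideal because
  \<open>h\<close> after evaluation is the class map: whatever evaluates to zero already has class
  zero.\<close>

lemma presented_iso:
  assumes X: "complex_algebra X \<sigma>" and f: "\<And>g. f g \<in> carrier X"
    and rel: "\<And>r. r \<in> R \<Longrightarrow> free_eval X \<sigma> f r = \<zero>\<^bsub>X\<^esub>"
    and h: "h \<in> ring_hom X (presented S R)"
    and h_scal: "\<And>c. h (\<sigma> c) = pclass S R (scal c)"
    and h_gen: "\<And>g. g \<in> S \<Longrightarrow> h (f g) = pclass S R (gen g)"
    and onto: "carrier X \<subseteq> free_eval X \<sigma> f ` carrier (free_alg_on S)"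
  shows "\<exists>\<phi>\<in>ring_iso (presented S R) X.
    \<forall>x\<in>carrier (free_alg_on S). \<phi> (pclass S R x) = free_eval X \<sigma> f x"
proof -
  let ?e = "free_eval X \<sigma> f" and ?F = "free_alg_on S"
  interpret X: ring X using X unfolding complex_algebra_def by blast
  note e = free_eval_props[where f = f, OF X f]
  have e_hom: "?e \<in> ring_hom ?F X"
    using e(1) by (auto simp: ring_hom_def)
  interpret E: ring_hom_ring ?F X ?e
    by (rule ring_hom_ringI2[OF ring_free_alg_on X.ring_axioms e_hom])
  \<comment> \<open>Both sides are homomorphisms out of the free algebra that agree on scalars and
    generators.\<close>
  have he: "h (?e x) = pclass S R x" if "x \<in> carrier ?F" for x
  proof -
    have "(h \<circ> ?e) x = pclass S R x"
      by (rule free_alg_on_hom_unique[OF ring_hom_trans[OF e_hom h] pclass_ring_hom _ _ that])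
        (simp_all add: e h_scal h_gen)
    then show ?thesis by simp
  qed
  have ker: "a_kernel ?F X ?e = genideal ?F R"
  proof
    show "a_kernel ?F X ?e \<subseteq> genideal ?F R"
    proof
      fix x assume "x \<in> a_kernel ?F X ?e"
      then have x: "x \<in> carrier ?F" "?e x = \<zero>\<^bsub>X\<^esub>" unfolding a_kernel_def' by blast+
      have "?e 0 = \<zero>\<^bsub>X\<^esub>" using E.hom_zero by simp
      then have "pclass S R x = pclass S R 0"
        using he x free_alg_on_closed(1)[of S] by metis
      then show "x \<in> genideal ?F R"
        using pclass_eq_iff[of x 0] x free_alg_on_closed(1)[of S] by simp
    qed
    show "genideal ?F R \<subseteq> a_kernel ?F X ?e"
      by (rule ring.genideal_minimal[OF ring_free_alg_on E.kernel_is_ideal])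
        (use R rel in \<open>unfold a_kernel_def', blast\<close>)
  qed
  have "?e ` carrier ?F = carrier X"
    using onto E.hom_closed by auto
  then have iso: "(\<lambda>Y. the_elem (?e ` Y)) \<in> ring_iso (presented S R) X"
    using E.FactRing_iso_set ker by (simp add: presented_def)
  \<comment> \<open>The isomorphism sends a coset to the single element of its image, so its values
    on classes follow once evaluation is constant on each coset.\<close>
  have "?e ` pclass S R x = {?e x}" if x: "x \<in> carrier ?F" for x
  proof -
    interpret I: ideal "genideal ?F R" ?F by (rule ideal_presented)
    have "?e y = ?e x" if "y \<in> pclass S R x" for y
    proof -
      from that obtain k where k: "k \<in> genideal ?F R" "y = k + x"
        by (auto simp: pclass_def a_r_coset_def r_coset_def)
      have "?e k = \<zero>\<^bsub>X\<^esub>" "k \<in> carrier ?F"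
        using k(1) ker unfolding a_kernel_def' by blast+
      then show ?thesis using E.hom_add[of k x] x k(2) by simp
    qed
    moreover have "x \<in> pclass S R x"
      using I.zero_closed
      by (auto simp: pclass_def a_r_coset_def r_coset_def intro!: bexI[of _ 0])
    ultimately show ?thesis by blast
  qed
  with iso show ?thesis by (intro bexI[of _ "\<lambda>Y. the_elem (?e ` Y)"]) auto
qed

end


subsection \<open>Weak M-structures with an adapted basis\<close>

locale weak_M =
  fixes L :: "('l::ab_group_add) mdata"
  assumes weak_M: "weak_M_structure L"
begin

sublocale vector_space "mscale L"
  using weak_M unfolding weak_M_structure_def by blast

abbreviation sc (infixr "\<cdot>" 75) where "c \<cdot> x \<equiv> mscale L c x"

lemma unit_mem: "munit L \<in> spA L" "munit L \<in> spB L"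
  using weak_M unfolding weak_M_structure_def by blast+

lemma subspace_A: "subspace (spA L)" and subspace_B: "subspace (spB L)"
  using weak_M unfolding weak_M_structure_def by blast+

lemma form_sym: "mform L x y = mform L y x"
  using weak_M unfolding weak_M_structure_def by (elim conjE) metis

lemma form_left:
  "mform L (x + x') y = mform L x y + mform L x' y" "mform L (c \<cdot> x) y = c * mform L x y"
  using weak_M unfolding weak_M_structure_def bilinear_on_def by (elim conjE; meson UNIV_I)+

lemma form_right:
  "mform L y (x + x') = mform L y x + mform L y x'" "mform L y (c \<cdot> x) = c * mform L y x"
  using form_left by (metis form_sym)+

lemma form_zero: "mform L 0 y = 0" "mform L y 0 = 0"
  using form_left(1)[of 0 0 y] form_right(1)[of y 0 0] by simp_all

lemma form_diff: "mform L (x - x') y = mform L x y - mform L x' y"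
    "mform L y (x - x') = mform L y x - mform L y x'"
  using form_left(1)[of "x - x'" x' y] form_right(1)[of y "x - x'" x'] by simp_all

lemma form_minus: "mform L (- x) y = - mform L x y" "mform L y (- x) = - mform L y x"
  using form_diff(1)[of 0 x y] form_diff(2)[of y 0 x] by (simp_all add: form_zero)

lemma form_sum: "mform L (sum f I) y = (\<Sum>i\<in>I. mform L (f i) y)"
    "mform L y (sum f I) = (\<Sum>i\<in>I. mform L y (f i))"
  by (induction I rule: infinite_finite_induct) (simp_all add: form_zero form_left form_right)

lemmas form_linear = form_left form_right form_zero form_diff form_minus form_sum

lemma nondegenerate: "(\<And>y. mform L x y = 0) \<Longrightarrow> x = 0"
  using weak_M unfolding weak_M_structure_def by (elim conjE; meson)

lemma isotropic: "a \<in> spA L \<Longrightarrow> a' \<in> spA L \<Longrightarrow> mform L a a' = 0"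
    "b \<in> spB L \<Longrightarrow> b' \<in> spB L \<Longrightarrow> mform L b b' = 0"
  using weak_M unfolding weak_M_structure_def by (elim conjE; meson)+

lemma mulA_unit: "a \<in> spA L \<Longrightarrow> mulA L (munit L) a = a" "a \<in> spA L \<Longrightarrow> mulA L a (munit L) = a"
  using weak_M unfolding weak_M_structure_def unital_algebra_on_def by (elim conjE; meson)+

lemma mulB_unit: "b \<in> spB L \<Longrightarrow> mulB L (munit L) b = b" "b \<in> spB L \<Longrightarrow> mulB L b (munit L) = b"
  using weak_M unfolding weak_M_structure_def unital_algebra_on_def by (elim conjE; meson)+

lemma mul_closed: "a \<in> spA L \<Longrightarrow> a' \<in> spA L \<Longrightarrow> mulA L a a' \<in> spA L"
    "b \<in> spB L \<Longrightarrow> b' \<in> spB L \<Longrightarrow> mulB L b b' \<in> spB L"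
  using weak_M unfolding weak_M_structure_def unital_algebra_on_def by (elim conjE; meson)+

lemma lact_left:
  "b \<in> spB L \<Longrightarrow> b' \<in> spB L \<Longrightarrow> lact L (b + b') w = lact L b w + lact L b' w"
  "b \<in> spB L \<Longrightarrow> lact L (c \<cdot> b) w = c \<cdot> lact L b w"
  using weak_M unfolding weak_M_structure_def bilinear_on_def by (elim conjE; meson UNIV_I)+

lemma lact_right:
  "b \<in> spB L \<Longrightarrow> lact L b (w + w') = lact L b w + lact L b w'"
  "b \<in> spB L \<Longrightarrow> lact L b (c \<cdot> w) = c \<cdot> lact L b w"
  using weak_M unfolding weak_M_structure_def bilinear_on_def by (elim conjE; meson UNIV_I)+

lemma ract_left:
  "a \<in> spA L \<Longrightarrow> ract L (w + w') a = ract L w a + ract L w' a"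
  "a \<in> spA L \<Longrightarrow> ract L (c \<cdot> w) a = c \<cdot> ract L w a"
  using weak_M unfolding weak_M_structure_def bilinear_on_def by (elim conjE; meson UNIV_I)+

lemma ract_zero: "a \<in> spA L \<Longrightarrow> ract L 0 a = 0"
  using ract_left(1)[of a 0 0] by simp

lemma ract_sum: "a \<in> spA L \<Longrightarrow> ract L (sum f I) a = (\<Sum>i\<in>I. ract L (f i) a)"
  by (induction I rule: infinite_finite_induct) (simp_all add: ract_zero ract_left)

lemma ract_right:
  "a \<in> spA L \<Longrightarrow> a' \<in> spA L \<Longrightarrow> ract L w (a + a') = ract L w a + ract L w a'"
  "a \<in> spA L \<Longrightarrow> ract L w (c \<cdot> a) = c \<cdot> ract L w a"
  using weak_M unfolding weak_M_structure_def bilinear_on_def by (elim conjE; meson UNIV_I)+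

lemma lact_unit: "lact L (munit L) w = w"
  and ract_unit: "ract L w (munit L) = w"
  using weak_M unfolding weak_M_structure_def by (elim conjE; meson)+

lemma lact_eq_mulB: "b \<in> spB L \<Longrightarrow> b' \<in> spB L \<Longrightarrow> lact L b b' = mulB L b b'"
  and ract_eq_mulA: "a \<in> spA L \<Longrightarrow> a' \<in> spA L \<Longrightarrow> ract L a a' = mulA L a a'"
  using weak_M unfolding weak_M_structure_def by (elim conjE; meson)+

lemma lact_mulB: "b \<in> spB L \<Longrightarrow> b' \<in> spB L \<Longrightarrow> lact L (mulB L b b') w = lact L b (lact L b' w)"
  and ract_mulA: "a \<in> spA L \<Longrightarrow> a' \<in> spA L \<Longrightarrow> ract L w (mulA L a a') = ract L (ract L w a) a'"
  and ract_lact: "b \<in> spB L \<Longrightarrow> a \<in> spA L \<Longrightarrow> ract L (lact L b w) a = lact L b (ract L w a)"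
  using weak_M unfolding weak_M_structure_def by (elim conjE; meson)+

lemma form_mulB: "b \<in> spB L \<Longrightarrow> b' \<in> spB L \<Longrightarrow> mform L (mulB L b b') w = mform L b (lact L b' w)"
  and form_mulA: "a \<in> spA L \<Longrightarrow> a' \<in> spA L \<Longrightarrow> mform L w (mulA L a a') = mform L (ract L w a) a'"
  using weak_M unfolding weak_M_structure_def by (elim conjE; meson)+

text \<open>Let the commuting actions meet at the unit: (b1)a = b(1a).\<close>

lemma ract_eq_lact: "b \<in> spB L \<Longrightarrow> a \<in> spA L \<Longrightarrow> ract L b a = lact L b a"
  using ract_lact[of b a "munit L"] unit_mem
  by (simp add: lact_eq_mulB ract_eq_mulA mulA_unit mulB_unit)

lemma lact_unit_right: "b \<in> spB L \<Longrightarrow> lact L b (munit L) = b"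
  using unit_mem by (simp add: lact_eq_mulB mulB_unit)

lemma ract_unit_left: "a \<in> spA L \<Longrightarrow> ract L (munit L) a = a"
  using unit_mem by (simp add: ract_eq_mulA mulA_unit)

text \<open>The subspaces \<open>spA L\<close> and \<open>spB L\<close> are isotropic and both
  contain the unit, so the unit is orthogonal to their sum. Hence \<open>C\<close> lies outside this
  sum, and codimension one does the rest.\<close>

lemma span_insert_outside:
  assumes "mform L (munit L) C \<noteq> 0"
  shows "span (insert C {a + b | a b. a \<in> spA L \<and> b \<in> spB L}) = UNIV"
proof -
  let ?V = "{a + b | a b. a \<in> spA L \<and> b \<in> spB L}"
  have "\<exists>S. finite S \<and> span S = UNIV"
    using weak_M unfolding weak_M_structure_def by (elim conjE)
  then obtain S where S: "finite S" "span S = UNIV" by blast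
  \<comment> \<open>A basis inside the finite spanning set makes dimension counting
    available.\<close>
  obtain T where T: "T \<subseteq> S" "independent T" "S \<subseteq> span T"
    by (rule maximal_independent_subset[of S])
  have "span T = UNIV"
    using S(2) T(3) span_minimal[OF T(3) subspace_span] by blast
  then interpret finite_dimensional_vector_space "mscale L" T
    using S(1) T by unfold_locales (auto intro: finite_subset)
  have "span ?V = ?V"
    by (rule span_eq_iff[THEN iffD2, OF subspace_sums[OF subspace_A subspace_B]])
  moreover have "mform L (munit L) x = 0" if "x \<in> ?V" for x
    using that unit_mem by (auto simp: form_right isotropic)
  ultimately have "C \<notin> span ?V"
    using assms by blast
  moreover have "dim (UNIV :: 'l set) = dim ?V + 1"
    using weak_M unfolding weak_M_structure_def by (elim conjE)
  ultimately have "dim (insert C ?V) = dim (UNIV :: 'l set)"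
    by (simp add: dim_insert)
  then show ?thesis
    by (intro subspace_dim_equal) auto
qed

text \<open>The functional given by pairing with \<open>y\<close> kills the span of all other
  elements of \<open>P\<close>, so \<open>a\<close> cannot lie in that span.\<close>

lemma independent_if_dual:
  assumes "\<And>a. a \<in> P \<Longrightarrow> \<exists>y. mform L a y \<noteq> 0 \<and> (\<forall>b\<in>P - {a}. mform L b y = 0)"
  shows "independent P"
  unfolding dependent_def
proof safe
  fix a assume a: "a \<in> P" "a \<in> span (P - {a})"
  then obtain y where y: "mform L a y \<noteq> 0" "\<forall>b\<in>P - {a}. mform L b y = 0"
    using assms by blast
  have "subspace {w. mform L w y = 0}"
    by (rule subspaceI) (simp_all add: form_linear)
  then have "span (P - {a}) \<subseteq> {w. mform L w y = 0}"
    using y(2) by (intro span_minimal) auto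
  then show False using a(2) y(1) by auto
qed

text \<open>A vector not orthogonal to the unit exists by nondegeneracy; it is corrected in three
  steps, each preserving what the earlier ones achieved.\<close>

lemma adapted_basis_exists:
  assumes A: "unital_basis L (spA L) p A" and B: "unital_basis L (spB L) p B"
    and AB: "\<forall>i\<in>{1..p}. \<forall>j\<in>{1..p}. mform L (A i) (B j) = (if i = j then 1 else 0)"
  obtains C where "adapted_basis L p A B C"
proof -
  have mem: "A i \<in> spA L" "B i \<in> spB L" if "i \<in> {1..p}" for i
    using A B that span_base[of "A i" "insert (munit L) (A ` {1..p})"]
      span_base[of "B i" "insert (munit L) (B ` {1..p})"]
    by (simp_all add: unital_basis_def)
  have "munit L \<noteq> 0"
    using A dependent_zero unfolding unital_basis_def by (metis insertI1)
  then obtain y where y: "mform L (munit L) y \<noteq> 0" using nondegenerate by blast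
  \<comment> \<open>Scaling makes the pairing with the unit equal to 1.\<close>
  define w where "w = (1 / mform L (munit L) y) \<cdot> y"
  \<comment> \<open>Since the \<open>A j\<close> and \<open>B j\<close> are dual and isotropic, this
    removes the pairings with all of them; the unit is orthogonal to what is subtracted.\<close>
  define w' where "w' = w - (\<Sum>j\<in>{1..p}. mform L w (B j) \<cdot> A j) - (\<Sum>j\<in>{1..p}. mform L w (A j) \<cdot> B j)"
  \<comment> \<open>Subtracting t times the unit lowers the square of \<open>w'\<close> by 2t,
    because (1,1) = 0 and (1,w') = 1. The pairings with 1, \<open>A i\<close> and \<open>B i\<close>
    do not change.\<close>
  define C where "C = w' - (mform L w' w' / 2) \<cdot> munit L"
  have BA: "mform L (B i) (A j) = (if i = j then 1 else 0)" if "i \<in> {1..p}" "j \<in> {1..p}" for i j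
    using AB that form_sym by auto
  have iso: "mform L (A i) (munit L) = 0" "mform L (munit L) (A i) = 0"
    "mform L (B i) (munit L) = 0" "mform L (munit L) (B i) = 0"
    "mform L (munit L) (munit L) = 0" if "i \<in> {1..p}" for i
    using that unit_mem mem isotropic by auto
  have uu: "mform L (munit L) (munit L) = 0" using unit_mem isotropic by blast
  have iso2: "mform L (A i) (A j) = 0" "mform L (B i) (B j) = 0" if "i \<in> {1..p}" "j \<in> {1..p}" for i j
    using that mem isotropic by auto
  have 1: "mform L (munit L) w' = 1" "mform L w' (munit L) = 1"
    using y form_sym[of w' "munit L"] by (simp_all add: w'_def w_def form_linear iso)
  have "mform L w' (A i) = 0" "mform L w' (B i) = 0" if "i \<in> {1..p}" for i
    using that by (simp_all add: w'_def form_linear iso2 AB BA if_distrib[of "(*) _"] sum.delta cong: if_cong)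
  then have "adapted_basis L p A B C"
    unfolding adapted_basis_def using A B AB
    by (simp add: C_def form_linear iso 1 uu)
  then show thesis by (rule that)
qed

end

locale adapted_M = weak_M L for L :: "('l::ab_group_add) mdata" +
  fixes p :: nat and A B :: "nat \<Rightarrow> 'l" and C :: 'l
  assumes adapted: "adapted_basis L p A B C"
begin

lemma span_A: "span (insert (munit L) (A ` {1..p})) = spA L"
  and span_B: "span (insert (munit L) (B ` {1..p})) = spB L"
  using adapted unfolding adapted_basis_def unital_basis_def by blast+

lemma A_mem: "i \<in> {1..p} \<Longrightarrow> A i \<in> spA L" and B_mem: "i \<in> {1..p} \<Longrightarrow> B i \<in> spB L"
  unfolding span_A[symmetric] span_B[symmetric] by (simp_all add: span_base)

lemma form_basis:
  "i \<in> {1..p} \<Longrightarrow> j \<in> {1..p} \<Longrightarrow> mform L (A i) (B j) = (if i = j then 1 else 0)"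
  "i \<in> {1..p} \<Longrightarrow> j \<in> {1..p} \<Longrightarrow> mform L (B i) (A j) = (if i = j then 1 else 0)"
  "i \<in> {1..p} \<Longrightarrow> j \<in> {1..p} \<Longrightarrow> mform L (A i) (A j) = 0"
  "i \<in> {1..p} \<Longrightarrow> j \<in> {1..p} \<Longrightarrow> mform L (B i) (B j) = 0"
  "i \<in> {1..p} \<Longrightarrow> mform L (A i) C = 0" "i \<in> {1..p} \<Longrightarrow> mform L C (A i) = 0"
  "i \<in> {1..p} \<Longrightarrow> mform L (B i) C = 0" "i \<in> {1..p} \<Longrightarrow> mform L C (B i) = 0"
  "i \<in> {1..p} \<Longrightarrow> mform L (A i) (munit L) = 0" "i \<in> {1..p} \<Longrightarrow> mform L (munit L) (A i) = 0"
  "i \<in> {1..p} \<Longrightarrow> mform L (B i) (munit L) = 0" "i \<in> {1..p} \<Longrightarrow> mform L (munit L) (B i) = 0"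
  "mform L (munit L) (munit L) = 0" "mform L C C = 0"
  "mform L (munit L) C = 1" "mform L C (munit L) = 1"
  using adapted isotropic A_mem B_mem unit_mem form_sym[of "B i" "A j"] form_sym[of C "munit L"]
    form_sym[of C "A i"] form_sym[of C "B i"]
  unfolding adapted_basis_def by auto

lemma span_basis: "span ({munit L, C} \<union> A ` {1..p} \<union> B ` {1..p}) = UNIV"
proof -
  let ?S = "{munit L, C} \<union> A ` {1..p} \<union> B ` {1..p}"
  have "spA L \<subseteq> span ?S" "spB L \<subseteq> span ?S"
    unfolding span_A[symmetric] span_B[symmetric] by (intro span_mono; blast)+
  then have "insert C {a + b | a b. a \<in> spA L \<and> b \<in> spB L} \<subseteq> span ?S"
    by (auto intro: span_base span_add)
  from span_minimal[OF this subspace_span] have "UNIV \<subseteq> span ?S"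
    using span_insert_outside[of C] by (simp add: form_basis)
  then show ?thesis by blast
qed

lemma basis_induct [case_names subspace unit C A B]:
  assumes "subspace {w. P w}" "P (munit L)" "P C"
    and "\<And>i. i \<in> {1..p} \<Longrightarrow> P (A i)" "\<And>i. i \<in> {1..p} \<Longrightarrow> P (B i)"
  shows "P w"
proof -
  have "span ({munit L, C} \<union> A ` {1..p} \<union> B ` {1..p}) \<subseteq> {w. P w}"
    using assms by (intro span_minimal) auto
  then show ?thesis using span_basis by auto
qed

section \<open>Expansion in an adapted basis and the presentation by the action table\<close>

lemma form_ext:
  assumes "mform L w (munit L) = mform L w' (munit L)" "mform L w C = mform L w' C"
    and "\<And>i. i \<in> {1..p} \<Longrightarrow> mform L w (A i) = mform L w' (A i)"
    and "\<And>i. i \<in> {1..p} \<Longrightarrow> mform L w (B i) = mform L w' (B i)"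
  shows "w = w'"
proof -
  have "mform L (w - w') y = 0" for y
    by (induction y rule: basis_induct)
      (simp_all add: assms form_diff subspace_def form_linear algebra_simps)
  then show ?thesis using nondegenerate[of "w - w'"] by simp
qed

text \<open>With respect to the form, the basis dual to 1, \<open>A k\<close>, \<open>B k\<close>,
  \<open>C\<close> is \<open>C\<close>, \<open>B k\<close>, \<open>A k\<close>, 1. Each coefficient
  is therefore the pairing with the dual vector.\<close>

lemma expansion:
  "w = mform L w C \<cdot> munit L + (\<Sum>k\<in>{1..p}. mform L w (B k) \<cdot> A k)
     + (\<Sum>k\<in>{1..p}. mform L w (A k) \<cdot> B k) + mform L w (munit L) \<cdot> C"
  by (rule form_ext)
    (simp_all add: form_linear form_basis if_distrib[of "(*) _"] sum.delta cong: if_cong)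

text \<open>This is the linear lift of \<open>expansion\<close> to the free algebra. The unit of
  \<open>L\<close> becomes the scalar 1, so it needs no generator of its own.\<close>

definition coord :: "'l \<Rightarrow> mgen free_alg" where
  "coord w = scal (mform L w C) + (\<Sum>k\<in>{1..p}. scal (mform L w (B k)) * gen (GA k))
     + (\<Sum>k\<in>{1..p}. scal (mform L w (A k)) * gen (GB k)) + scal (mform L w (munit L)) * gen GC"

lemma coord_closed: "coord w \<in> carrier (free_alg_on (mgens p))"
  unfolding coord_def
  by (intro free_alg_on_closed free_alg_on_sum) (auto simp: mgens_def)

lemma coord_add: "coord (w + w') = coord w + coord w'"
  by (simp add: coord_def form_left scal_simps algebra_simps sum.distrib)

lemma coord_scale: "coord (c \<cdot> w) = scal c * coord w"
  by (simp add: coord_def form_left scal_simps algebra_simps sum_distrib_left)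

lemma coord_zero: "coord 0 = 0"
  using coord_add[of 0 0] by simp

lemma coord_diff: "coord (w - w') = coord w - coord w'"
  using coord_add[of "w - w'" w'] by simp

lemma coord_sum: "coord (sum f I) = (\<Sum>i\<in>I. coord (f i))"
  by (induction I rule: infinite_finite_induct) (simp_all add: coord_zero coord_add)

lemma coord_basis:
  "coord (munit L) = 1" "coord C = gen GC"
  "i \<in> {1..p} \<Longrightarrow> coord (A i) = gen (GA i)" "i \<in> {1..p} \<Longrightarrow> coord (B i) = gen (GB i)"
  by (simp_all add: coord_def form_basis scal_simps if_distrib[of scal]
      if_distrib[of "\<lambda>x. x * _"] sum.delta cong: if_cong)

text \<open>Only products covered by one of the two actions occur; words such as \<open>A i\<close>
  \<open>B j\<close>, \<open>A i\<close> \<open>C\<close>, \<open>C\<close> \<open>B j\<close> or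
  \<open>C\<close> \<open>C\<close> get no relation.\<close>

definition struct_rels :: "mgen free_alg set" where
  "struct_rels =
     {gen (GA i) * gen (GA j) - coord (ract L (A i) (A j)) | i j. i \<in> {1..p} \<and> j \<in> {1..p}} \<union>
     {gen (GB i) * gen (GB j) - coord (lact L (B i) (B j)) | i j. i \<in> {1..p} \<and> j \<in> {1..p}} \<union>
     {gen (GB i) * gen (GA j) - coord (lact L (B i) (A j)) | i j. i \<in> {1..p} \<and> j \<in> {1..p}} \<union>
     {gen (GB i) * gen GC - coord (lact L (B i) C) | i. i \<in> {1..p}} \<union>
     {gen GC * gen (GA j) - coord (ract L C (A j)) | j. j \<in> {1..p}}"

lemma struct_rels_mem:
  assumes "i \<in> {1..p}" "j \<in> {1..p}"
  shows "gen (GA i) * gen (GA j) - coord (ract L (A i) (A j)) \<in> struct_rels"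
    "gen (GB i) * gen (GB j) - coord (lact L (B i) (B j)) \<in> struct_rels"
    "gen (GB i) * gen (GA j) - coord (lact L (B i) (A j)) \<in> struct_rels"
    "gen (GB i) * gen GC - coord (lact L (B i) C) \<in> struct_rels"
    "gen GC * gen (GA j) - coord (ract L C (A j)) \<in> struct_rels"
  using assms unfolding struct_rels_def by blast+

lemma mgens_mem: "i \<in> {1..p} \<Longrightarrow> GA i \<in> mgens p" "i \<in> {1..p} \<Longrightarrow> GB i \<in> mgens p" "GC \<in> mgens p"
  by (auto simp: mgens_def)

lemma struct_rels_closed: "struct_rels \<subseteq> carrier (free_alg_on (mgens p))"
  unfolding struct_rels_def
  by (auto intro!: free_alg_on_closed coord_closed mgens_mem)

text \<open>Every entry of the table is an instance of one of the two action laws, so it holds in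
  any algebra realizing \<open>L\<close>.\<close>

lemma struct_rels_action:
  assumes "r \<in> struct_rels"
  shows "(\<exists>b\<in>spB L. \<exists>w. r = coord b * coord w - coord (lact L b w)) \<or>
    (\<exists>a\<in>spA L. \<exists>w. r = coord w * coord a - coord (ract L w a))"
  using assms unfolding struct_rels_def by (elim UnE CollectE exE conjE) (metis coord_basis(2-4) A_mem B_mem)+

text \<open>The defect \<open>?D\<close> is bilinear and the ideal is closed under sums and scalars,
  so basis vectors suffice. There the defect vanishes if one factor is the unit and is a defining
  relation otherwise.\<close>

lemma coord_ideal_lact:
  assumes b: "b \<in> spB L"
  shows "coord b * coord w - coord (lact L b w) \<in> genideal (free_alg_on (mgens p)) struct_rels"
proof -
  let ?I = "genideal (free_alg_on (mgens p)) struct_rels"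
  note I = presented_ideal_closed[OF struct_rels_closed]
  let ?D = "\<lambda>b w. coord b * coord w - coord (lact L b w)"
  have basis: "?D (B i) w \<in> ?I" if i: "i \<in> {1..p}" for i w
  proof (induction w rule: basis_induct)
    case subspace
    have "?D (B i) (w + w') = ?D (B i) w + ?D (B i) w'" for w w'
      using B_mem[OF i] by (simp add: lact_right coord_add algebra_simps)
    moreover have "?D (B i) (c \<cdot> w) = scal c * ?D (B i) w" for c w
      using B_mem[OF i]
      by (simp add: lact_right coord_scale right_diff_distrib scal_left_commute)
    moreover have "?D (B i) 0 = 0"
      using lact_right(1)[OF B_mem[OF i], of 0 0] by (simp add: coord_zero)
    ultimately show ?case using I(1-3) by (simp add: subspace_def)
  next
    case unit
    show ?case using B_mem[OF i] I(1) by (simp add: lact_unit_right coord_basis)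
  qed (use i in \<open>simp_all add: coord_basis I(4) struct_rels_mem\<close>)
  \<comment> \<open>Membership in \<open>spB L\<close> is part of the set because the action is
    linear in \<open>b\<close> only there.\<close>
  have "subspace {b \<in> spB L. \<forall>w. ?D b w \<in> ?I}"
  proof -
    have "?D (b + b') w = ?D b w + ?D b' w" if "b \<in> spB L" "b' \<in> spB L" for b b' w
      using that by (simp add: lact_left coord_add algebra_simps)
    moreover have "?D (c \<cdot> b) w = scal c * ?D b w" if "b \<in> spB L" for b c w
      using that by (simp add: lact_left coord_scale right_diff_distrib mult.assoc)
    moreover have "?D 0 w = 0" for w
      using lact_left(2)[OF unit_mem(2), of 0 w] by (simp add: coord_zero)
    ultimately show ?thesis using I(1-3) subspace_B by (simp add: subspace_def)
  qed
  then have "spB L \<subseteq> {b \<in> spB L. \<forall>w. ?D b w \<in> ?I}"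
    unfolding span_B[symmetric]
    using basis unit_mem B_mem span_B I(1) by (intro span_minimal) (auto simp: coord_basis lact_unit)
  with b show ?thesis by blast
qed

lemma coord_ideal_ract:
  assumes a: "a \<in> spA L"
  shows "coord w * coord a - coord (ract L w a) \<in> genideal (free_alg_on (mgens p)) struct_rels"
proof -
  let ?I = "genideal (free_alg_on (mgens p)) struct_rels"
  note I = presented_ideal_closed[OF struct_rels_closed]
  let ?D = "\<lambda>w a. coord w * coord a - coord (ract L w a)"
  have basis: "?D w (A j) \<in> ?I" if j: "j \<in> {1..p}" for j w
  proof (induction w rule: basis_induct)
    case subspace
    have "?D (w + w') (A j) = ?D w (A j) + ?D w' (A j)" for w w'
      using A_mem[OF j] by (simp add: ract_left coord_add algebra_simps)
    moreover have "?D (c \<cdot> w) (A j) = scal c * ?D w (A j)" for c w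
      using A_mem[OF j] by (simp add: ract_left coord_scale right_diff_distrib mult.assoc)
    moreover have "?D 0 (A j) = 0"
      using A_mem[OF j] by (simp add: ract_zero coord_zero)
    ultimately show ?case using I(1-3) by (simp add: subspace_def)
  next
    case unit
    show ?case using A_mem[OF j] I(1) by (simp add: ract_unit_left coord_basis)
  \<comment> \<open>For \<open>w = B i\<close> the table records the left action on
    \<open>A j\<close>; by \<open>ract_eq_lact\<close> this is the same vector.\<close>
  qed (use j in \<open>simp_all add: coord_basis I(4) struct_rels_mem ract_eq_lact A_mem B_mem\<close>)
  have "subspace {a \<in> spA L. \<forall>w. ?D w a \<in> ?I}"
  proof -
    have "?D w (a + a') = ?D w a + ?D w a'" if "a \<in> spA L" "a' \<in> spA L" for a a' w
      using that by (simp add: ract_right coord_add algebra_simps)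
    moreover have "?D w (c \<cdot> a) = scal c * ?D w a" if "a \<in> spA L" for a c w
      using that
      by (simp add: ract_right coord_scale right_diff_distrib scal_left_commute)
    moreover have "?D w 0 = 0" for w
      using ract_right(2)[OF unit_mem(1), of w 0] by (simp add: coord_zero)
    ultimately show ?thesis using I(1-3) subspace_A by (simp add: subspace_def)
  qed
  then have "spA L \<subseteq> {a \<in> spA L. \<forall>w. ?D w a \<in> ?I}"
    unfolding span_A[symmetric]
    using basis unit_mem A_mem span_A I(1) by (intro span_minimal) (auto simp: coord_basis ract_unit)
  with a show ?thesis by blast
qed

text \<open>By the universal property this yields the homomorphism from
  \<open>weak_M_algebra L\<close> back to the presented algebra, which \<open>presented_iso\<close>
  takes as \<open>h\<close>.\<close>

lemma presented_realizes:
  "realizes L (presented (mgens p) struct_rels) (\<lambda>c. pclass (mgens p) struct_rels (scal c))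
     (\<lambda>w. pclass (mgens p) struct_rels (coord w))"
proof -
  note R = struct_rels_closed
  have eq: "pclass (mgens p) struct_rels (coord x * coord y) = pclass (mgens p) struct_rels (coord z)"
    if "coord x * coord y - coord z \<in> genideal (free_alg_on (mgens p)) struct_rels" for x y z
    using that by (simp add: pclass_eq_iff[OF R] coord_closed free_alg_on_closed)
  show ?thesis
    unfolding realizes_def
    using complex_algebra_presented[OF R] coord_ideal_lact coord_ideal_ract
    by (auto simp: coord_closed free_alg_on_closed coord_add coord_scale coord_basis pclass_hom_simps(1)[OF R]
        intro!: eq simp flip: pclass_hom_simps(2-4)[OF R])
qed

definition emb_gen :: "mgen \<Rightarrow> 'l free_alg set" where
  "emb_gen g = (case g of GA i \<Rightarrow> emb L (A i) | GB i \<Rightarrow> emb L (B i) | GC \<Rightarrow> emb L C)"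

lemma emb_gen_simps [simp]:
  "emb_gen (GA i) = emb L (A i)" "emb_gen (GB i) = emb L (B i)" "emb_gen GC = emb L C"
  by (simp_all add: emb_gen_def)

text \<open>Evaluating the generators at the embedded basis turns \<open>coord w\<close> into
  \<open>emb L w\<close>. Hence the relations hold in \<open>weak_M_algebra L\<close> and evaluation
  is onto, as \<open>presented_iso\<close> requires.\<close>

lemma weak_M_algebra_presentation:
  "\<exists>\<phi>\<in>ring_iso (presented (mgens p) struct_rels) (weak_M_algebra L).
     (\<forall>z. \<phi> (pclass (mgens p) struct_rels (scal z)) = uscal L z) \<and>
     (\<forall>i\<in>{1..p}. \<phi> (pclass (mgens p) struct_rels (gen (GA i))) = emb L (A i)) \<and>
     (\<forall>i\<in>{1..p}. \<phi> (pclass (mgens p) struct_rels (gen (GB i))) = emb L (B i)) \<and>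
     \<phi> (pclass (mgens p) struct_rels (gen GC)) = emb L C"
proof -
  let ?U = "weak_M_algebra L" and ?P = "presented (mgens p) struct_rels"
  let ?F = "free_alg_on (mgens p)" and ?c = "pclass (mgens p) struct_rels"
  let ?e = "free_eval ?U (uscal L) emb_gen"
  have real: "realizes L ?U (uscal L) (emb L)" by (rule weak_M_algebra_realizes)
  then have X: "complex_algebra ?U (uscal L)" and emb: "\<And>w. emb L w \<in> carrier ?U"
    unfolding realizes_def by blast+
  interpret U: ring ?U using X unfolding complex_algebra_def by blast
  have f: "emb_gen g \<in> carrier ?U" for g
    by (simp add: emb_gen_def emb split: mgen.split)
  note e = free_eval_props[where f = emb_gen, OF X f]
  have e_simps: "?e (x + y) = ?e x \<oplus>\<^bsub>?U\<^esub> ?e y" "?e (x * y) = ?e x \<otimes>\<^bsub>?U\<^esub> ?e y"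
      "?e 1 = \<one>\<^bsub>?U\<^esub>" "?e x \<in> carrier ?U" for x y
    using e(1) by (simp_all add: ring_hom_def Pi_def)
  have e_coord: "?e (coord w) = emb L w" for w
  proof (induction w rule: basis_induct)
    case subspace
    \<comment> \<open>Neither \<open>realizes\<close> nor \<open>complex_algebra\<close> says where
      zero goes; the images of zero satisfy x + x = x and therefore vanish.\<close>
    have "?e 0 = uscal L 0" using e(3)[of 0] by (simp add: scal_simps)
    also have "uscal L 0 \<oplus>\<^bsub>?U\<^esub> uscal L 0 = uscal L 0" "uscal L 0 \<in> carrier ?U"
      using X unfolding complex_algebra_def by (metis add.right_neutral)+
    moreover have "emb L 0 \<oplus>\<^bsub>?U\<^esub> emb L 0 = emb L 0"
      using real unfolding realizes_def by (metis add.right_neutral)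
    ultimately have "?e 0 = emb L 0"
      using emb[of 0] by (metis U.add.r_cancel_one')
    then show ?case
      using real unfolding realizes_def subspace_def
      by (simp add: coord_zero coord_add coord_scale e_simps e)
  next
    case unit
    then show ?case using real unfolding realizes_def by (simp add: coord_basis e_simps)
  qed (simp_all add: coord_basis e)
  have e_diff: "?e (x - y) = \<zero>\<^bsub>?U\<^esub>" if "?e x = ?e y" for x y
  proof -
    have "?e x = ?e (x - y) \<oplus>\<^bsub>?U\<^esub> ?e y" by (simp flip: e_simps(1))
    then show ?thesis using that e_simps(4) by (metis U.add.r_cancel_one')
  qed
  have rel: "?e r = \<zero>\<^bsub>?U\<^esub>" if "r \<in> struct_rels" for r
  proof -
    have "emb L b \<otimes>\<^bsub>?U\<^esub> emb L w = emb L (lact L b w)" if "b \<in> spB L" for b w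
      using real that unfolding realizes_def by blast
    moreover have "emb L w \<otimes>\<^bsub>?U\<^esub> emb L a = emb L (ract L w a)" if "a \<in> spA L" for a w
      using real that unfolding realizes_def by blast
    ultimately show ?thesis
      using struct_rels_action[OF that] e_diff e_simps(2) e_coord by metis
  qed
  obtain h where h: "h \<in> ring_hom ?U ?P" "\<And>w. h (emb L w) = ?c (coord w)"
      "\<And>c. h (uscal L c) = ?c (scal c)"
    using weak_M_algebra_hom_exists[OF presented_realizes] by blast
  note U_simps = pclass_simps[of "weak_M_rels L", folded weak_M_algebra_def]
  \<comment> \<open>The elements \<open>emb L w\<close> and the scalars generate
    \<open>weak_M_algebra L\<close>, and \<open>emb L w\<close> is the value at
    \<open>coord w\<close>.\<close>
  have onto: "carrier ?U \<subseteq> ?e ` carrier ?F"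
  proof
    fix y assume "y \<in> carrier ?U"
    then obtain x where x: "y = pclass UNIV (weak_M_rels L) x"
      using pclass_surj unfolding weak_M_algebra_def by metis
    have "x \<in> carrier (free_alg_on UNIV)" by simp
    then have "\<exists>z\<in>carrier ?F. pclass UNIV (weak_M_rels L) x = ?e z"
    proof (induction rule: free_alg_on_induct)
      case (scal c)
      show ?case
        using free_alg_on_closed(3) e(3) uscal_def by metis
    next
      case (gen w x)
      then obtain z where "z \<in> carrier ?F" "pclass UNIV (weak_M_rels L) x = ?e z" by blast
      then show ?case
        using coord_closed[of w] e_coord[of w]
        by (intro bexI[of _ "coord w * z"])
          (simp_all add: free_alg_on_closed e_simps U_simps emb_def)
    next
      case (add x y)
      then obtain z z' where "z \<in> carrier ?F" "pclass UNIV (weak_M_rels L) x = ?e z"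
        "z' \<in> carrier ?F" "pclass UNIV (weak_M_rels L) y = ?e z'" by blast
      then show ?case
        by (intro bexI[of _ "z + z'"])
          (simp_all add: free_alg_on_closed e_simps U_simps)
    qed
    then show "y \<in> ?e ` carrier ?F" using x by auto
  qed
  have h_gen: "h (emb_gen g) = ?c (gen g)" if "g \<in> mgens p" for g
    using that by (auto simp: mgens_def h(2) coord_basis)
  obtain \<phi> where "\<phi> \<in> ring_iso ?P ?U" "\<And>x. x \<in> carrier ?F \<Longrightarrow> \<phi> (?c x) = ?e x"
    using presented_iso[where f = emb_gen, OF struct_rels_closed X f rel h(1,3) h_gen onto] by blast
  then show ?thesis
    by (intro bexI[of _ \<phi>]) (simp_all add: free_alg_on_closed mgens_mem e)
qed

text \<open>After the shift \<open>C\<close> pairs with the new \<open>B i\<close> to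
  \<open>c i\<close>. Subtracting the \<open>c j\<close> multiples of the \<open>A j\<close> cancels
  this by duality; the other pairings survive because 1, \<open>A j\<close> and \<open>C\<close> are
  orthogonal to every \<open>A j\<close>.\<close>

lemma adapted_basis_shift:
  "adapted_basis L p A (\<lambda>i. B i + c i \<cdot> munit L) (C - (\<Sum>j\<in>{1..p}. c j \<cdot> A j))"
proof -
  let ?B = "\<lambda>i. B i + c i \<cdot> munit L" and ?C = "C - (\<Sum>j\<in>{1..p}. c j \<cdot> A j)"
  have BA: "mform L (?B i) (A j) = (if i = j then 1 else 0)" "mform L (A j) (?B i) = (if i = j then 1 else 0)"
    if "i \<in> {1..p}" "j \<in> {1..p}" for i j
    using that by (auto simp: form_linear form_basis)
  have uA: "mform L (munit L) (A j) = 0" if "j \<in> {1..p}" for j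
    using that by (simp add: form_basis)
  have uC: "mform L (munit L) ?C = 1"
    by (simp add: form_linear form_basis)
  have BC: "mform L (?B i) ?C = 0" if "i \<in> {1..p}" for i
    using that by (simp add: form_linear form_basis if_distrib[of "(*) _"] sum.delta cong: if_cong)
  have inj: "inj_on ?B {1..p}"
    using BA by (intro inj_onI) (metis zero_neq_one)
  have nin: "munit L \<notin> ?B ` {1..p}"
    using BC uC by (metis (no_types, lifting) image_iff zero_neq_one)
  have ind: "independent (insert (munit L) (?B ` {1..p}))"
  proof (rule independent_if_dual)
    fix a assume "a \<in> insert (munit L) (?B ` {1..p})"
    then consider "a = munit L" | i where "i \<in> {1..p}" "a = ?B i" by blast
    then show "\<exists>y. mform L a y \<noteq> 0 \<and> (\<forall>b\<in>insert (munit L) (?B ` {1..p}) - {a}. mform L b y = 0)"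
    \<comment> \<open>The dual vectors are the corrected \<open>C\<close> for the unit and
      \<open>A i\<close> for the shifted \<open>B i\<close>.\<close>
    proof cases
      case 1
      then show ?thesis using uC BC by (intro exI[of _ ?C]) auto
    next
      case 2
      have "mform L b (A i) = 0" if "b \<in> insert (munit L) (?B ` {1..p}) - {a}" for b
        using that 2 uA BA by auto
      moreover have "mform L a (A i) \<noteq> 0" using 2 BA by simp
      ultimately show ?thesis by blast
    qed
  qed
  have "span (insert (munit L) (?B ` {1..p})) = span (insert (munit L) (B ` {1..p}))"
  proof
    show "span (insert (munit L) (?B ` {1..p})) \<subseteq> span (insert (munit L) (B ` {1..p}))"
      by (intro span_minimal) (auto intro!: span_add span_scale intro: span_base)
    have "B i \<in> span (insert (munit L) (?B ` {1..p}))" if "i \<in> {1..p}" for i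
    proof -
      have "?B i - c i \<cdot> munit L \<in> span (insert (munit L) (?B ` {1..p}))"
        using that by (intro span_diff span_scale span_base) auto
      then show ?thesis by simp
    qed
    then show "span (insert (munit L) (B ` {1..p})) \<subseteq> span (insert (munit L) (?B ` {1..p}))"
      by (intro span_minimal) (auto intro: span_base)
  qed
  then have "unital_basis L (spB L) p ?B"
    unfolding unital_basis_def using inj nin ind span_B by simp
  moreover have "mform L ?C (A i) = 0" if "i \<in> {1..p}" for i
    using that by (simp add: form_linear form_basis)
  moreover have "mform L ?C (?B i) = 0" if "i \<in> {1..p}" for i
    using BC[OF that] form_sym by metis
  moreover have "mform L ?C ?C = 0"
    by (simp add: form_linear form_basis)
  moreover have "unital_basis L (spA L) p A"
    using adapted unfolding adapted_basis_def by blast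
  ultimately show ?thesis
    using BA uC unfolding adapted_basis_def by simp
qed

section \<open>Moving the actions across the form\<close>

lemma form_unit_lact: "b \<in> spB L \<Longrightarrow> mform L (munit L) (lact L b w) = mform L b w"
  using form_mulB[of "munit L" b w] unit_mem by (simp add: mulB_unit)

lemma form_lact: "b \<in> spB L \<Longrightarrow> b' \<in> spB L \<Longrightarrow> mform L b (lact L b' w) = mform L (lact L b b') w"
  by (simp add: form_mulB lact_eq_mulB)

lemma form_ract_unit: "a \<in> spA L \<Longrightarrow> mform L (ract L w a) (munit L) = mform L w a"
  using form_mulA[of a "munit L" w] unit_mem by (simp add: mulA_unit)

lemma form_ract: "a \<in> spA L \<Longrightarrow> a' \<in> spA L \<Longrightarrow> mform L (ract L w a) a' = mform L w (ract L a a')"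
  by (simp add: form_mulA ract_eq_mulA)

lemma lact_assoc: "b \<in> spB L \<Longrightarrow> b' \<in> spB L \<Longrightarrow> lact L (lact L b b') w = lact L b (lact L b' w)"
  by (simp add: lact_mulB lact_eq_mulB)

lemma lact_mem: "b \<in> spB L \<Longrightarrow> b' \<in> spB L \<Longrightarrow> lact L b b' \<in> spB L"
  by (simp add: lact_eq_mulB mul_closed)

end


subsection \<open>Idempotent bases of \<open>\<A>\<close>\<close>

text \<open>By \<open>expansion\<close>, \<open>normal\<close> says that the product of
  \<open>B i\<close> and \<open>A i\<close> has no component along 1. This is what the shift of the
  \<open>B i\<close> achieves.\<close>

locale semisimple_M = adapted_M +
  assumes idem: "\<lbrakk>i \<in> {1..p}; j \<in> {1..p}\<rbrakk> \<Longrightarrow> mulA L (A i) (A j) = (if i = j then A i else 0)"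
    and normal: "i \<in> {1..p} \<Longrightarrow> mform L C (lact L (B i) (A i)) = 0"
begin

declare One_nat_def [simp del]

text \<open>By \<open>expansion\<close>, pairing with \<open>A j\<close> reads off the coefficient
  of \<open>B j\<close>, and pairing with \<open>C\<close> the constant term. So \<open>u i\<close>,
  \<open>v i\<close> and \<open>q i j\<close> are structure constants of
  \<open>spB L\<close>.\<close>

definition u :: "nat \<Rightarrow> complex" where "u i = mform L (lact L (B i) (B i)) (A i)"
definition v :: "nat \<Rightarrow> complex" where "v i = mform L (lact L (B i) (B i)) C"
definition q :: "nat \<Rightarrow> nat \<Rightarrow> complex" where "q i j = mform L (lact L (B i) (B j)) (A j)"

section \<open>Products of the \<open>B i\<close> with the idempotents\<close>

lemma ract_A_A:
  "i \<in> {1..p} \<Longrightarrow> j \<in> {1..p} \<Longrightarrow> ract L (A i) (A j) = (if i = j then A i else 0)"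
  using ract_eq_mulA[of "A i" "A j"] A_mem idem by simp

lemma ract_sum_A:
  assumes "j \<in> {1..p}"
  shows "ract L (\<Sum>k\<in>{1..p}. x k \<cdot> A k) (A j) = x j \<cdot> A j"
proof -
  have "ract L (x k \<cdot> A k) (A j) = (if k = j then x j \<cdot> A j else 0)" if "k \<in> {1..p}" for k
    using that assms A_mem[of j] by (simp add: ract_left ract_A_A)
  then show ?thesis using assms A_mem[OF assms] by (simp add: ract_sum)
qed

text \<open>Invariance of the form moves \<open>A j\<close> to the other side: the pairing becomes
  that of \<open>B i\<close> with the product of \<open>A j\<close> and \<open>A k\<close>.\<close>

lemma form_lact_A:
  assumes "i \<in> {1..p}" "j \<in> {1..p}" "k \<in> {1..p}"
  shows "mform L (lact L (B i) (A j)) (A k) = (if i = j \<and> j = k then 1 else 0)"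
proof -
  have "mform L (lact L (B i) (A j)) (A k) = mform L (B i) (ract L (A j) (A k))"
    using assms by (simp add: form_ract A_mem B_mem flip: ract_eq_lact)
  then show ?thesis using assms by (simp add: ract_A_A form_basis form_zero)
qed

lemma form_lact_A_unit:
  assumes "i \<in> {1..p}" "j \<in> {1..p}"
  shows "mform L (lact L (B i) (A j)) (munit L) = (if i = j then 1 else 0)"
  using assms form_unit_lact[of "B i" "A j"] form_sym B_mem by (simp add: form_basis)

text \<open>The left side is the \<open>A k\<close> coefficient of \<open>B i\<close> acting on
  \<open>w\<close>. For \<open>w = A j\<close> it thus becomes a structure constant of
  \<open>spB L\<close>.\<close>

lemma form_lact_A_B:
  assumes "i \<in> {1..p}" "k \<in> {1..p}"
  shows "mform L (lact L (B i) w) (B k) = mform L (lact L (B k) (B i)) w"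
  using assms form_lact[of "B k" "B i" w] form_sym B_mem by simp

lemma ract_lact_A:
  assumes "i \<in> {1..p}" "j \<in> {1..p}" "k \<in> {1..p}"
  shows "ract L (lact L (B i) (A j)) (A k) = (if j = k then lact L (B i) (A j) else 0)"
proof -
  have "lact L (B i) 0 = 0" using lact_right(2)[of "B i" 0 0] B_mem assms by simp
  then show ?thesis
    using assms by (simp add: ract_lact A_mem B_mem ract_A_A)
qed

lemma lact_A_off_diag:
  assumes "i \<in> {1..p}" "j \<in> {1..p}" "i \<noteq> j"
  shows "lact L (B i) (A j) = mform L (lact L (B j) (B i)) (A j) \<cdot> A j"
proof -
  let ?w = "lact L (B i) (A j)"
  have "?w = mform L ?w C \<cdot> munit L + (\<Sum>k\<in>{1..p}. mform L ?w (B k) \<cdot> A k)"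
    using expansion[of ?w] assms by (simp add: form_lact_A form_lact_A_unit)
  then have "ract L ?w (A j) = ract L (mform L ?w C \<cdot> munit L + (\<Sum>k\<in>{1..p}. mform L ?w (B k) \<cdot> A k)) (A j)"
    by simp
  \<comment> \<open>Right multiplication by \<open>A j\<close> fixes \<open>?w\<close>, sends 1 to
    \<open>A j\<close> and kills every other \<open>A k\<close>.\<close>
  then have w: "?w = (mform L ?w C + mform L ?w (B j)) \<cdot> A j"
    using assms A_mem by (simp add: ract_lact_A ract_left ract_sum_A ract_unit_left scale_left_distrib)
  \<comment> \<open>Pairing with \<open>B j\<close> shows that the constant term of
    \<open>?w\<close> is zero.\<close>
  then have "mform L ?w (B j) = mform L ?w C + mform L ?w (B j)"
    using assms by (metis form_left(2) form_basis(1) mult.right_neutral)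
  then show ?thesis
    using w assms by (simp add: form_lact_A_B)
qed

text \<open>This number is also the \<open>A k\<close> coefficient of \<open>B i\<close> acting on
  \<open>A j\<close>, which is a multiple of \<open>A j\<close>. So a product of two
  \<open>B\<close>s involves no third one.\<close>

lemma structure_const_zero:
  assumes "i \<in> {1..p}" "j \<in> {1..p}" "k \<in> {1..p}" "i \<noteq> j" "k \<noteq> j"
  shows "mform L (lact L (B k) (B i)) (A j) = 0"
  using form_lact_A_B[of i k "A j"] lact_A_off_diag[of i j] assms
  by (simp add: form_left form_basis)

text \<open>Compare pairings with the basis: \<open>B i\<close> comes from
  \<open>form_lact_A\<close>, \<open>C\<close> from \<open>form_lact_A_unit\<close>, and
  \<open>normal\<close> removes the constant.\<close>

lemma lact_A_diag:
  assumes "i \<in> {1..p}"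
  shows "lact L (B i) (A i) = (\<Sum>k\<in>{1..p}. mform L (lact L (B k) (B i)) (A i) \<cdot> A k) + B i + C"
  using assms normal[OF assms] form_sym[of C "lact L (B i) (A i)"]
  by (intro form_ext)
    (simp_all add: form_linear form_basis form_lact_A form_lact_A_unit form_lact_A_B
      if_distrib[of "(*) _"] sum.delta cong: if_cong)

text \<open>Multiply \<open>lact_A_diag\<close> by \<open>A i\<close> on the right. The left side is
  unchanged, the sum collapses to its \<open>A i\<close> term, and the product of \<open>B i\<close>
  and \<open>A i\<close> cancels.\<close>

lemma ract_C:
  assumes "i \<in> {1..p}"
  shows "ract L C (A i) = (- u i) \<cdot> A i"
proof -
  have "lact L (B i) (A i) = ract L (lact L (B i) (A i)) (A i)"
    using assms by (simp add: ract_lact_A)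
  also have "\<dots> = ract L ((\<Sum>k\<in>{1..p}. mform L (lact L (B k) (B i)) (A i) \<cdot> A k) + B i + C) (A i)"
    using lact_A_diag[OF assms] by simp
  also have "\<dots> = u i \<cdot> A i + lact L (B i) (A i) + ract L C (A i)"
    using assms A_mem B_mem by (simp add: ract_left ract_sum_A ract_eq_lact u_def)
  finally have "u i \<cdot> A i + ract L C (A i) = 0"
    by (simp add: algebra_simps)
  then show ?thesis by (simp add: eq_neg_iff_add_eq_0 add.commute)
qed

text \<open>The case that is neither a definition nor zero is \<open>k = i\<close> with
  \<open>i\<close> and \<open>j\<close> distinct; it ties the \<open>B i\<close> coefficient to
  \<open>q i j\<close> through the orthogonality of \<open>A j\<close> and
  \<open>A i\<close>.\<close>

lemma form_BB:
  assumes "i \<in> {1..p}" "j \<in> {1..p}" "k \<in> {1..p}"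
  shows "mform L (lact L (B i) (B j)) (A k) =
    (if k = j then if i = j then u i else q i j else if k = i then u i - q i j else 0)"
proof (cases "k = j \<or> k \<noteq> i")
  case True
  then show ?thesis using structure_const_zero[of j k i] assms by (auto simp: u_def q_def)
next
  case False
  then have k: "k = i" "i \<noteq> j" by auto
  \<comment> \<open>Right multiplication by \<open>A i\<close> kills the left side of
    \<open>lact_A_diag\<close> for \<open>j\<close> and turns every term on its right into a
    multiple of \<open>A i\<close>.\<close>
  have "0 = ract L (lact L (B j) (A j)) (A i)"
    using assms k by (simp add: ract_lact_A)
  also have "\<dots> = ract L ((\<Sum>k\<in>{1..p}. mform L (lact L (B k) (B j)) (A j) \<cdot> A k) + B j + C) (A i)"
    using lact_A_diag[OF assms(2)] by simp
  also have "\<dots> = q i j \<cdot> A i + lact L (B j) (A i) + ract L C (A i)"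
    using assms A_mem B_mem by (simp add: ract_left ract_sum_A ract_eq_lact q_def)
  also have "\<dots> = (q i j + mform L (lact L (B i) (B j)) (A i) - u i) \<cdot> A i"
    using assms k by (simp add: lact_A_off_diag ract_C scale_left_distrib scale_left_diff_distrib)
  finally have "mform L 0 (B i) = mform L ((q i j + mform L (lact L (B i) (B j)) (A i) - u i) \<cdot> A i) (B i)"
    by (rule arg_cong)
  then show ?thesis using assms k by (simp add: form_linear form_basis algebra_simps)
qed

section \<open>The multiplication table of \<open>spB L\<close>\<close>

lemma lact_BB_expansion:
  assumes "i \<in> {1..p}" "j \<in> {1..p}"
  shows "lact L (B i) (B j) = (\<Sum>k\<in>{1..p}. mform L (lact L (B i) (B j)) (A k) \<cdot> B k)
    + mform L (lact L (B i) (B j)) C \<cdot> munit L"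
proof -
  have "mform L (lact L (B i) (B j)) b = 0" if "b \<in> spB L" for b
    using that assms by (intro isotropic lact_mem B_mem)
  then show ?thesis
    using expansion[of "lact L (B i) (B j)"] assms unit_mem B_mem by (simp add: add.commute)
qed

lemma lact_BB_diag:
  assumes "i \<in> {1..p}"
  shows "lact L (B i) (B i) = u i \<cdot> B i + v i \<cdot> munit L"
proof -
  have "(\<Sum>k\<in>{1..p}. mform L (lact L (B i) (B i)) (A k) \<cdot> B k)
      = (\<Sum>k\<in>{1..p}. if k = i then u i \<cdot> B i else 0)"
    using assms by (intro sum.cong) (auto simp: form_BB)
  then show ?thesis using assms lact_BB_expansion[of i i] by (simp add: v_def)
qed

text \<open>The constant term is still unknown here; associativity identifies it with
  \<open>v i\<close> in \<open>assoc_iij\<close>.\<close>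

lemma lact_BB_off_diag_weak:
  assumes "i \<in> {1..p}" "j \<in> {1..p}" "i \<noteq> j"
  shows "lact L (B i) (B j) = (u i - q i j) \<cdot> B i + q i j \<cdot> B j
    + mform L (lact L (B i) (B j)) C \<cdot> munit L"
proof -
  have "(\<Sum>k\<in>{1..p}. mform L (lact L (B i) (B j)) (A k) \<cdot> B k)
      = (\<Sum>k\<in>{1..p}. (if k = i then (u i - q i j) \<cdot> B i else 0) + (if k = j then q i j \<cdot> B j else 0))"
    using assms by (intro sum.cong) (auto simp: form_BB)
  also have "\<dots> = (u i - q i j) \<cdot> B i + q i j \<cdot> B j"
    using assms by (simp add: sum.distrib)
  finally show ?thesis using assms lact_BB_expansion[of i j] by simp
qed

section \<open>Equations forced by associativity\<close>

lemmas lact_lin = lact_left lact_right subspace_scale[OF subspace_B] subspace_add[OF subspace_B]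
  B_mem unit_mem lact_unit lact_unit_right

text \<open>Compare the two bracketings of \<open>B i\<close>, \<open>B i\<close>,
  \<open>B j\<close>. The \<open>B j\<close> coefficients give the quadratic equation, and with it
  the \<open>B i\<close> coefficients determine the constant.\<close>

lemma assoc_iij:
  assumes "i \<in> {1..p}" "j \<in> {1..p}" "i \<noteq> j"
  shows "(q i j)\<^sup>2 = u i * q i j + v i"
    and "mform L (lact L (B i) (B j)) C = v i"
proof -
  let ?v = "mform L (lact L (B i) (B j)) C"
  have "lact L (lact L (B i) (B i)) (B j) = lact L (B i) (lact L (B i) (B j))"
    using assms B_mem by (simp add: lact_assoc)
  also have "\<dots> = lact L (B i) ((u i - q i j) \<cdot> B i + q i j \<cdot> B j + ?v \<cdot> munit L)"
    by (rule arg_cong[OF lact_BB_off_diag_weak[OF assms]])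
  also have "\<dots> = (u i - q i j) \<cdot> lact L (B i) (B i) + q i j \<cdot> lact L (B i) (B j) + ?v \<cdot> B i"
    using assms by (simp add: lact_lin)
  also have "lact L (lact L (B i) (B i)) (B j) = u i \<cdot> lact L (B i) (B j) + v i \<cdot> B j"
    using assms by (simp add: lact_BB_diag lact_lin)
  finally have eq: "u i \<cdot> lact L (B i) (B j) + v i \<cdot> B j =
      (u i - q i j) \<cdot> lact L (B i) (B i) + q i j \<cdot> lact L (B i) (B j) + ?v \<cdot> B i" .
  show q: "(q i j)\<^sup>2 = u i * q i j + v i"
    using arg_cong[OF eq, of "\<lambda>w. mform L w (A j)"] assms
    by (simp add: form_left form_BB form_basis power2_eq_square)
  have "u i * (u i - q i j) = (u i - q i j) * u i + q i j * (u i - q i j) + ?v"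
    using arg_cong[OF eq, of "\<lambda>w. mform L w (A i)"] assms
    by (simp add: form_left form_BB form_basis)
  then show "?v = v i" using q by (simp add: power2_eq_square algebra_simps)
qed

lemma lact_BB_off_diag:
  assumes "i \<in> {1..p}" "j \<in> {1..p}" "i \<noteq> j"
  shows "lact L (B i) (B j) = (u i - q i j) \<cdot> B i + q i j \<cdot> B j + v i \<cdot> munit L"
  using lact_BB_off_diag_weak[OF assms] assoc_iij(2)[OF assms] by simp

text \<open>Here the \<open>B i\<close> coefficients of the two bracketings of \<open>B i\<close>,
  \<open>B j\<close>, \<open>B j\<close> are compared.\<close>

lemma assoc_ijj:
  assumes "i \<in> {1..p}" "j \<in> {1..p}" "i \<noteq> j"
  shows "(u i - q i j)\<^sup>2 = u j * (u i - q i j) + v j"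
proof -
  have "lact L (lact L (B i) (B j)) (B j) = lact L (B i) (lact L (B j) (B j))"
    using assms B_mem by (simp add: lact_assoc)
  also have "lact L (B i) (lact L (B j) (B j)) = u j \<cdot> lact L (B i) (B j) + v j \<cdot> B i"
    using assms by (simp add: lact_BB_diag lact_lin)
  also have "lact L (lact L (B i) (B j)) (B j) =
      (u i - q i j) \<cdot> lact L (B i) (B j) + q i j \<cdot> lact L (B j) (B j) + v i \<cdot> B j"
    by (subst (1) lact_BB_off_diag[OF assms]) (use assms in \<open>simp add: lact_lin\<close>)
  finally have eq: "(u i - q i j) \<cdot> lact L (B i) (B j) + q i j \<cdot> lact L (B j) (B j) + v i \<cdot> B j =
      u j \<cdot> lact L (B i) (B j) + v j \<cdot> B i" .
  show ?thesis
    using arg_cong[OF eq, of "\<lambda>w. mform L w (A i)"] assms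
    by (simp add: form_left form_BB form_basis power2_eq_square)
qed

lemma assoc_ijk:
  assumes "i \<in> {1..p}" "j \<in> {1..p}" "k \<in> {1..p}" "i \<noteq> j" "j \<noteq> k" "i \<noteq> k"
  shows "(q i k - q j k) * (q i k - q i j) = 0"
proof -
  have "lact L (lact L (B i) (B j)) (B k) = lact L (B i) (lact L (B j) (B k))"
    using assms B_mem by (simp add: lact_assoc)
  also have "lact L (B i) (lact L (B j) (B k)) =
      (u j - q j k) \<cdot> lact L (B i) (B j) + q j k \<cdot> lact L (B i) (B k) + v j \<cdot> B i"
    using assms by (simp add: lact_BB_off_diag[of j k] lact_lin)
  also have "lact L (lact L (B i) (B j)) (B k) =
      (u i - q i j) \<cdot> lact L (B i) (B k) + q i j \<cdot> lact L (B j) (B k) + v i \<cdot> B k"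
    using assms by (simp add: lact_BB_off_diag[of i j] lact_lin)
  finally have eq: "(u i - q i j) \<cdot> lact L (B i) (B k) + q i j \<cdot> lact L (B j) (B k) + v i \<cdot> B k =
      (u j - q j k) \<cdot> lact L (B i) (B j) + q j k \<cdot> lact L (B i) (B k) + v j \<cdot> B i" .
  have "(u i - q i j) * q i k + q i j * q j k + v i = q j k * q i k"
    using arg_cong[OF eq, of "\<lambda>w. mform L w (A k)"] assms
    by (simp add: form_left form_BB form_basis)
  \<comment> \<open>The quadratic equation for the pair \<open>i\<close>, \<open>k\<close>
    eliminates \<open>v i\<close>; the \<open>u i\<close> terms cancel and the rest factors.\<close>
  moreover have "v i = q i k * q i k - u i * q i k"
    using assoc_iij(1)[of i k] assms by (simp add: power2_eq_square)
  ultimately show ?thesis by (simp add: algebra_simps)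
qed

lemma lact_C:
  assumes i: "i \<in> {1..p}"
  shows "lact L (B i) C = (\<Sum>k\<in>{1..p}. v k \<cdot> A k) - u i \<cdot> B i - v i \<cdot> munit L"
proof -
  let ?w = "lact L (B i) C"
  \<comment> \<open>The pairing is the constant term of the product of \<open>B k\<close> and
    \<open>B i\<close>, which by \<open>assoc_iij\<close> depends on the left factor only.\<close>
  have wB: "mform L ?w (B k) = v k" if "k \<in> {1..p}" for k
    using form_lact_A_B[of i k C] assoc_iij(2)[of k i] that i by (cases "k = i") (auto simp: v_def)
  \<comment> \<open>Moving \<open>A k\<close> onto \<open>?w\<close> makes it act on
    \<open>C\<close>, where \<open>ract_C\<close> applies.\<close>
  have wA: "mform L ?w (A k) = (if k = i then - u i else 0)" if "k \<in> {1..p}" for k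
  proof -
    have "mform L ?w (A k) = mform L (ract L ?w (A k)) (munit L)"
      using that by (simp add: form_ract_unit A_mem)
    also have "ract L ?w (A k) = (- u k) \<cdot> lact L (B i) (A k)"
      using that i by (simp add: ract_lact ract_C A_mem B_mem lact_right del: scale_minus_left)
    finally show ?thesis
      using that i by (simp add: form_left form_lact_A_unit del: scale_minus_left)
  qed
  have w1: "mform L ?w (munit L) = 0"
    using form_unit_lact[of "B i" C] form_sym[of ?w] B_mem i by (simp add: form_basis)
  have w: "?w = mform L ?w C \<cdot> munit L + (\<Sum>k\<in>{1..p}. v k \<cdot> A k) - u i \<cdot> B i"
    using i by (intro form_ext)
      (simp_all add: form_linear form_basis wA wB w1 if_distrib[of "(*) _"] sum.delta cong: if_cong)
  \<comment> \<open>The remaining constant is found by multiplying with \<open>A i\<close> on the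
    right in two ways, through \<open>ract_C\<close> and through the expansion of
    \<open>?w\<close>.\<close>
  have "(- u i) \<cdot> lact L (B i) (A i) = ract L ?w (A i)"
    using i by (simp add: ract_lact ract_C A_mem B_mem lact_right del: scale_minus_left)
  also have "\<dots> = ract L (mform L ?w C \<cdot> munit L + (\<Sum>k\<in>{1..p}. v k \<cdot> A k) + (- u i) \<cdot> B i) (A i)"
    using w by simp
  also have "\<dots> = mform L ?w C \<cdot> A i + v i \<cdot> A i + (- u i) \<cdot> lact L (B i) (A i)"
    using i A_mem B_mem by (simp add: ract_left ract_sum_A ract_eq_lact ract_unit_left del: scale_minus_left)
  finally have "mform L (mform L ?w C \<cdot> A i + v i \<cdot> A i) (B i) = 0"
    by (simp add: form_zero)
  then have "mform L ?w C = - v i"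
    using i by (simp add: form_left form_basis eq_neg_iff_add_eq_0)
  then show ?thesis using w by simp
qed

text \<open>Substituting the computed products makes the relations agree literally, once the
  \<open>BB\<close> and \<open>BA\<close> families are split into diagonal and off-diagonal
  parts.\<close>

lemma mrels_eq_struct_rels: "mrels p u v q = struct_rels"
proof -
  have split: "{f i j | i j. i \<in> {1..p} \<and> j \<in> {1..p}} =
      {f i j | i j. i \<in> {1..p} \<and> j \<in> {1..p} \<and> i \<noteq> j} \<union> {f i i | i. i \<in> {1..p}}"
    for f :: "nat \<Rightarrow> nat \<Rightarrow> mgen free_alg" by blast
  have cong2: "{f i j | i j. P i j} = {g i j | i j. P i j}" if "\<And>i j. P i j \<Longrightarrow> f i j = g i j"
    for f g :: "nat \<Rightarrow> nat \<Rightarrow> mgen free_alg" and P using that by metis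
  have cong1: "{f i | i. P i} = {g i | i. P i}" if "\<And>i. P i \<Longrightarrow> f i = g i"
    for f g :: "nat \<Rightarrow> mgen free_alg" and P using that by metis
  have AA: "{gen (GA i) * gen (GA j) - coord (ract L (A i) (A j)) | i j. i \<in> {1..p} \<and> j \<in> {1..p}} =
      {gen (GA i) * gen (GA j) - (if i = j then gen (GA i) else 0) | i j. i \<in> {1..p} \<and> j \<in> {1..p}}"
    by (rule cong2) (simp add: ract_A_A coord_basis coord_zero)
  have BB: "{gen (GB i) * gen (GB j) - coord (lact L (B i) (B j))
        | i j. i \<in> {1..p} \<and> j \<in> {1..p} \<and> i \<noteq> j} =
      {gen (GB i) * gen (GB j) - (scal (u i - q i j) * gen (GB i) + scal (q i j) * gen (GB j) + scal (v i))
        | i j. i \<in> {1..p} \<and> j \<in> {1..p} \<and> i \<noteq> j}"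
    by (rule cong2) (simp add: lact_BB_off_diag coord_add coord_scale coord_basis)
  have BB': "{gen (GB i) * gen (GB i) - coord (lact L (B i) (B i)) | i. i \<in> {1..p}} =
      {gen (GB i) * gen (GB i) - (scal (u i) * gen (GB i) + scal (v i)) | i. i \<in> {1..p}}"
    by (rule cong1) (simp add: lact_BB_diag coord_add coord_scale coord_basis)
  have BA: "{gen (GB i) * gen (GA j) - coord (lact L (B i) (A j))
        | i j. i \<in> {1..p} \<and> j \<in> {1..p} \<and> i \<noteq> j} =
      {gen (GB i) * gen (GA j) - scal (u j - q j i) * gen (GA j)
        | i j. i \<in> {1..p} \<and> j \<in> {1..p} \<and> i \<noteq> j}"
    by (rule cong2) (simp add: lact_A_off_diag form_BB coord_scale coord_basis)
  have diag: "coord (lact L (B i) (A i)) = scal (u i) * gen (GA i)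
      + (\<Sum>k\<in>{1..p} - {i}. scal (q k i) * gen (GA k)) + gen (GB i) + gen GC" if i: "i \<in> {1..p}" for i
  proof -
    have "(\<Sum>k\<in>{1..p}. mform L (lact L (B k) (B i)) (A i) \<cdot> A k) =
        u i \<cdot> A i + (\<Sum>k\<in>{1..p} - {i}. q k i \<cdot> A k)"
      using i by (subst sum.remove[of _ i]) (simp_all add: u_def q_def)
    then show ?thesis
      using i by (simp add: lact_A_diag coord_add coord_scale coord_sum coord_basis)
  qed
  have BA': "{gen (GB i) * gen (GA i) - coord (lact L (B i) (A i)) | i. i \<in> {1..p}} =
      {gen (GB i) * gen (GA i) - (scal (u i) * gen (GA i)
        + (\<Sum>k\<in>{1..p} - {i}. scal (q k i) * gen (GA k)) + gen (GB i) + gen GC) | i. i \<in> {1..p}}"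
    by (rule cong1) (simp only: diag)
  have BC: "{gen (GB i) * gen GC - coord (lact L (B i) C) | i. i \<in> {1..p}} =
      {gen (GB i) * gen GC - ((\<Sum>k\<in>{1..p}. scal (v k) * gen (GA k)) - scal (u i) * gen (GB i) - scal (v i))
        | i. i \<in> {1..p}}"
    by (rule cong1) (simp add: lact_C coord_diff coord_scale coord_sum coord_basis)
  have CA: "{gen GC * gen (GA j) - coord (ract L C (A j)) | j. j \<in> {1..p}} =
      {gen GC * gen (GA j) - (- scal (u j) * gen (GA j)) | j. j \<in> {1..p}}"
    by (rule cong1) (simp add: ract_C coord_scale coord_basis scal_minus del: scale_minus_left)
  show ?thesis
    unfolding mrels_def struct_rels_def AA CA BC
      split[of "\<lambda>i j. gen (GB i) * gen (GB j) - coord (lact L (B i) (B j))"]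
      split[of "\<lambda>i j. gen (GB i) * gen (GA j) - coord (lact L (B i) (A j))"] BB BB' BA BA'
    by (simp only: Un_assoc)
qed

end

theorem theorem2p5:
  fixes L :: "('l::ab_group_add) mdata"
    and p :: nat
    and A B :: "nat \<Rightarrow> 'l"
  assumes "M_structure L"
    and "unital_basis L (spA L) p A"
    and "\<forall>i\<in>{1..p}. \<forall>j\<in>{1..p}. mulA L (A i) (A j) = (if i = j then A i else 0)"
    and "unital_basis L (spB L) p B"
    and "\<forall>i\<in>{1..p}. \<forall>j\<in>{1..p}. mform L (A i) (B j) = (if i = j then 1 else 0)"
  shows "\<exists>(c :: nat \<Rightarrow> complex) (u :: nat \<Rightarrow> complex) (v :: nat \<Rightarrow> complex)
           (q :: nat \<Rightarrow> nat \<Rightarrow> complex) (B' :: nat \<Rightarrow> 'l) (C :: 'l).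
      (\<forall>i\<in>{1..p}. B' i = B i + mscale L (c i) (munit L)) \<and>
      adapted_basis L p A B' C \<and>
      (\<forall>i\<in>{1..p}. \<forall>j\<in>{1..p}. i \<noteq> j \<longrightarrow>
         mulB L (B' i) (B' j) =
           mscale L (u i - q i j) (B' i) + mscale L (q i j) (B' j) + mscale L (v i) (munit L)) \<and>
      (\<forall>i\<in>{1..p}.
         mulB L (B' i) (B' i) = mscale L (u i) (B' i) + mscale L (v i) (munit L)) \<and>
      (\<forall>i\<in>{1..p}. \<forall>j\<in>{1..p}. i \<noteq> j \<longrightarrow>
         (q i j)\<^sup>2 = u i * q i j + v i \<and>
         (u i - q i j)\<^sup>2 = u j * (u i - q i j) + v j) \<and>
      (\<forall>i\<in>{1..p}. \<forall>j\<in>{1..p}. \<forall>k\<in>{1..p}. i \<noteq> j \<and> j \<noteq> k \<and> i \<noteq> k \<longrightarrow>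
         (q i k - q j k) * (q i k - q i j) = 0) \<and>
      (\<exists>\<phi> \<in> ring_iso (presented (mgens p) (mrels p u v q)) (weak_M_algebra L).
         (\<forall>z. \<phi> (pclass (mgens p) (mrels p u v q) (scal z)) = uscal L z) \<and>
         (\<forall>i\<in>{1..p}. \<phi> (pclass (mgens p) (mrels p u v q) (gen (GA i))) = emb L (A i)) \<and>
         (\<forall>i\<in>{1..p}. \<phi> (pclass (mgens p) (mrels p u v q) (gen (GB i))) = emb L (B' i)) \<and>
         \<phi> (pclass (mgens p) (mrels p u v q) (gen GC)) = emb L C)"
proof -
  interpret weak_M L
    using assms(1) by unfold_locales (simp add: M_structure_def)
  obtain C0 where C0: "adapted_basis L p A B C0"
    using adapted_basis_exists[OF assms(2,4,5)] .
  interpret A0: adapted_M L p A B C0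
    using C0 by unfold_locales
  \<comment> \<open>This is the constant term of \<open>B i\<close> acting on \<open>A i\<close> in
    the original basis, which the shift has to remove.\<close>
  define c where "c i = mform L C0 (lact L (B i) (A i))" for i
  define B' where "B' i = B i + c i \<cdot> munit L" for i
  define C where "C = C0 - (\<Sum>j\<in>{1..p}. c j \<cdot> A j)"
  have ad: "adapted_basis L p A B' C"
    using A0.adapted_basis_shift[of c] by (simp add: B'_def[abs_def] C_def)
  interpret semisimple_M L p A B' C
  proof
    show "adapted_basis L p A B' C" by (rule ad)
    show "mulA L (A i) (A j) = (if i = j then A i else 0)" if "i \<in> {1..p}" "j \<in> {1..p}" for i j
      using assms(3) that by blast
    fix i assume i: "i \<in> {1..p}"
    \<comment> \<open>Hence passing from \<open>C0\<close> to \<open>C\<close> lowers the pairing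
      with this vector by exactly \<open>c i\<close>.\<close>
    have "mform L (A j) (lact L (B i) (A i)) = (if i = j then 1 else 0)" if j: "j \<in> {1..p}" for j
    proof -
      have "mform L (A j) (lact L (B i) (A i)) = mform L (ract L (B i) (A i)) (A j)"
        using i by (simp add: ract_eq_lact A0.A_mem A0.B_mem form_sym)
      also have "\<dots> = mform L (B i) (mulA L (A i) (A j))"
        using i j by (simp add: form_mulA A0.A_mem)
      finally show ?thesis
        using assms(3) i j by (simp add: A0.form_basis form_zero)
    qed
    then have "mform L C (lact L (B i) (A i)) = 0"
      using i by (simp add: C_def form_linear c_def[symmetric] if_distrib[of "(*) _"] sum.delta cong: if_cong)
    \<comment> \<open>The shift also adds \<open>c i\<close> times \<open>A i\<close> to the
      product, which is invisible to \<open>C\<close>.\<close>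
    moreover have "mform L C (A i) = 0"
      using ad i unfolding adapted_basis_def by blast
    ultimately show "mform L C (lact L (B' i) (A i)) = 0"
      using i unit_mem
      by (simp add: B'_def lact_left A0.B_mem subspace_scale[OF subspace_B] lact_unit form_right)
  qed
  have mul: "mulB L (B' i) (B' j) = lact L (B' i) (B' j)" if "i \<in> {1..p}" "j \<in> {1..p}" for i j
    using that by (simp add: lact_eq_mulB B_mem)
  show ?thesis
  proof (intro exI conjI ballI impI)
    show "B' i = B i + c i \<cdot> munit L" for i by (rule B'_def)
    show "adapted_basis L p A B' C" by (rule ad)
    fix i assume i: "i \<in> {1..p}"
    show "mulB L (B' i) (B' i) = u i \<cdot> B' i + v i \<cdot> munit L"
      using i by (simp add: mul lact_BB_diag)
    fix j assume j: "j \<in> {1..p}"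
    show "mulB L (B' i) (B' j) = (u i - q i j) \<cdot> B' i + q i j \<cdot> B' j + v i \<cdot> munit L"
      "(q i j)\<^sup>2 = u i * q i j + v i" "(u i - q i j)\<^sup>2 = u j * (u i - q i j) + v j" if "i \<noteq> j"
      using i j that by (simp_all add: mul lact_BB_off_diag assoc_iij(1) assoc_ijj)
    fix k assume "k \<in> {1..p}" "i \<noteq> j \<and> j \<noteq> k \<and> i \<noteq> k"
    then show "(q i k - q j k) * (q i k - q i j) = 0"
      using i j assoc_ijk by blast
  qed (use weak_M_algebra_presentation in \<open>simp only: mrels_eq_struct_rels\<close>)
qed

end
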